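(* Let $(X,\mathcal{B},\mu,f)$ be a measurable system. For every real $p\ge 1$, if $f$ satisfies the Summability Condition (SC), then the composition operator $T_f:L^p(X)\to L^p(X)$, $T_f\varphi=\varphi\circ f$, satisfies the Frequent Hypercyclicity Criterion (FHC). Moreover, for every real $p\ge 2$, $f$ satisfies (SC) if and only if $T_f:L^p(X)\to L^p(X)$ satisfies (FHC).
   Context: A measurable system is a tuple $(X,\mathcal{B},\mu,f)$ where: $(X,\mathcal{B},\mu)$ is a $\sigma$-finite measure space with $\mu(X)>0$; $f:X\to X$ is bijective, bimeasurable ($f(B),f^{-1}(B)\in\mathcal{B}$ for all $B\in\mathcal{B}$) and nonsingular ($\mu(f^{-1}(B))=0$ if and only if $\mu(B)=0$); and there is $c>0$ with $\mu(f^{-1}(B))\le c\,\mu(B)$ for all $B\in\mathcal{B}$. The last condition makes $T_f$ a continuous linear operator on $L^p(X)$. Summability Condition (SC): for each $\epsilon>0$ and each $B\in\mathcal{B}$ with $\mu(B)<\infty$ there is a measurable $B'\subseteq B$ with $\mu(B\setminus B')<\epsilon$ and $\sum_{n\in\mathbb{Z}}\mu(f^n(B'))<\infty$. A continuous linear operator $T$ on a Banach space $\mathcal{H}$ satisfies the Frequent Hypercyclicity Criterion (FHC) if there exist a dense subset $\mathcal{H}_0\subseteq\mathcal{H}$ (not required to be a subspace) and a map $S:\mathcal{H}_0\to\mathcal{H}_0$ (not required to be linear or continuous) such that for every $\varphi\in\mathcal{H}_0$: (a) the series $\sum_{n\ge1}T^n\varphi$ converges unconditionally; (b) the series $\sum_{n\ge1}S^n\varphi$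 converges unconditionally; (c) $TS\varphi=\varphi$. *)

theory Defs
  imports "HOL-Analysis.Analysis" "HOL-Algebra.Module"
begin

locale measurable_system = sigma_finite_measure M
  for M :: "'a measure" +
  fixes f :: "'a \<Rightarrow> 'a"
  assumes space_pos: "emeasure M (space M) > 0"
    and bij: "bij_betw f (space M) (space M)"
    and measurable_f: "f \<in> measurable M M"
    and image_sets: "\<And>B. B \<in> sets M \<Longrightarrow> f ` B \<in> sets M"
    and nonsingular:
      "\<And>B. B \<in> sets M \<Longrightarrow> emeasure M (f -` B \<inter> space M) = 0 \<longleftrightarrow> emeasure M B = 0"
    and bounded_distortion:
      "\<exists>c::real. c > 0 \<and> (\<forall>B\<in>sets M. emeasure M (f -` B \<inter> space M) \<le> ennreal c * emeasure M B)"

definition int_iterate :: "'a set \<Rightarrow> ('a \<Rightarrow> 'a) \<Rightarrow> int \<Rightarrow> 'a \<Rightarrow> 'a" where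
  "int_iterate X f n = (if n \<ge> 0 then f ^^ nat n else inv_into X f ^^ nat (- n))"

text \<open>The sum below is a sum of extended nonnegative reals, so it always exists.\<close>

definition summability_condition :: "'a measure \<Rightarrow> ('a \<Rightarrow> 'a) \<Rightarrow> bool" where
  "summability_condition M f \<longleftrightarrow>
    (\<forall>\<epsilon>::real. \<forall>B\<in>sets M. \<epsilon> > 0 \<and> emeasure M B < \<infinity> \<longrightarrow>
      (\<exists>B'\<in>sets M. B' \<subseteq> B \<and> emeasure M (B - B') < ennreal \<epsilon> \<and>
        (\<Sum>\<^sub>\<infinity>n::int. emeasure M (int_iterate (space M) f n ` B')) < \<infinity>))"

text \<open>
  The space \<open>L\<^sup>p(M)\<close> depends on the measure \<open>M\<close>, which is a term, so it cannot be a type of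
  class \<open>banach\<close>. Normed spaces are therefore given by an explicit carrier: a module record
  together with a norm.
\<close>

record ('k, 'v) normed_space = "('k, 'v) module" +
  vnorm :: "'v \<Rightarrow> real"

definition dense_in :: "('k, 'v, 'm) normed_space_scheme \<Rightarrow> 'v set \<Rightarrow> bool" where
  "dense_in H D \<longleftrightarrow> D \<subseteq> carrier H \<and>
    (\<forall>v\<in>carrier H. \<forall>\<epsilon>>0. \<exists>w\<in>D. vnorm H (v \<ominus>\<^bsub>H\<^esub> w) < \<epsilon>)"

text \<open>
  Unconditional convergence, as in \<^const>\<open>has_sum\<close>: the net of all finite partial sums converges
  in norm.
\<close>

definition unconditionally_convergent ::
    "('k, 'v, 'm) normed_space_scheme \<Rightarrow> ('i \<Rightarrow> 'v) \<Rightarrow> 'i set \<Rightarrow> bool" where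
  "unconditionally_convergent H x I \<longleftrightarrow>
    (\<exists>s\<in>carrier H.
      ((\<lambda>F. vnorm H (finsum H x F \<ominus>\<^bsub>H\<^esub> s)) \<longlongrightarrow> 0) (finite_subsets_at_top I))"

text \<open>Here \<open>H\<close> is meant to be a Banach space and \<open>T\<close> a continuous linear operator on it.\<close>

definition frequent_hypercyclicity_criterion ::
    "('k, 'v, 'm) normed_space_scheme \<Rightarrow> ('v \<Rightarrow> 'v) \<Rightarrow> bool" where
  "frequent_hypercyclicity_criterion H T \<longleftrightarrow>
    (\<exists>H\<^sub>0 S. dense_in H H\<^sub>0 \<and> S \<in> H\<^sub>0 \<rightarrow> H\<^sub>0 \<and>
      (\<forall>\<phi>\<in>H\<^sub>0.
        unconditionally_convergent H (\<lambda>n. (T ^^ n) \<phi>) {1::nat..} \<and>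
        unconditionally_convergent H (\<lambda>n. (S ^^ n) \<phi>) {1::nat..} \<and>
        T (S \<phi>) = \<phi>))"

text \<open>
  The space \<open>L\<^sup>p(M)\<close> of classes of almost everywhere equal functions. The scalars
  \<open>'k :: {real_normed_field, euclidean_space}\<close> are the reals or the complex numbers.
\<close>

definition lp_functions ::
    "'a measure \<Rightarrow> real \<Rightarrow> ('a \<Rightarrow> 'k::{real_normed_field, euclidean_space}) set" where
  "lp_functions M p =
    {g. g \<in> borel_measurable M \<and> integrable M (\<lambda>x. norm (g x) powr p)}"

definition lp_norm ::
    "'a measure \<Rightarrow> real \<Rightarrow> ('a \<Rightarrow> 'k::{real_normed_field, euclidean_space}) \<Rightarrow> real" where
  "lp_norm M p g = (LINT x|M. norm (g x) powr p) powr (1 / p)"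

definition ae_equal ::
    "'a measure \<Rightarrow> real \<Rightarrow>
      (('a \<Rightarrow> 'k::{real_normed_field, euclidean_space}) \<times> ('a \<Rightarrow> 'k)) set" where
  "ae_equal M p =
    {(g, h). g \<in> lp_functions M p \<and> h \<in> lp_functions M p \<and> (AE x in M. g x = h x)}"

text \<open>
  The fields \<open>mult\<close> and \<open>one\<close> are inherited from the ring record and have no meaning for modules.
\<close>

definition Lp ::
    "'a measure \<Rightarrow> real \<Rightarrow>
      ('k::{real_normed_field, euclidean_space}, ('a \<Rightarrow> 'k) set) normed_space" where
  "Lp M p = \<lparr>
    carrier = lp_functions M p // ae_equal M p,
    monoid.mult = undefined,
    one = undefined,
    zero = ae_equal M p `` {\<lambda>_. 0},
    add = (\<lambda>A B. \<Union>g\<in>A. \<Union>h\<in>B. ae_equal M p `` {\<lambda>x. g x + h x}),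
    smult = (\<lambda>a A. \<Union>g\<in>A. ae_equal M p `` {\<lambda>x. a * g x}),
    vnorm = (\<lambda>A. THE r. \<exists>g\<in>A. r = lp_norm M p g)\<rparr>"

definition composition_operator ::
    "'a measure \<Rightarrow> real \<Rightarrow> ('a \<Rightarrow> 'a) \<Rightarrow>
      ('a \<Rightarrow> 'k::{real_normed_field, euclidean_space}) set \<Rightarrow> ('a \<Rightarrow> 'k) set" where
  "composition_operator M p f A = (\<Union>g\<in>A. ae_equal M p `` {g \<circ> f})"

end

theory Submission
  imports Defs
begin

text \<open>
  Suppose (SC) holds. Given \<open>v\<close> in \<open>L\<^sup>p\<close>, restrict it to a set of finite measure on which it is bounded
  above and away from 0, then to a subset \<open>B\<close> given by (SC), and finally to the points of \<open>B\<close> whose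
  orbit visits \<open>B\<close> fewer than \<open>m\<close> times. The number of visits is an invariant integrable function,
  so the orbit of the restriction is absolutely summable with sum in \<open>L\<^sup>p\<close>. Such functions are thus dense;
  dominated convergence makes both series converge unconditionally, with \<open>S\<phi> = \<phi> \<circ> f\<^sup>-\<^sup>1\<close>.

  Conversely, for \<open>p \<ge> 2\<close> the space \<open>L\<^sup>p\<close> has cotype \<open>p\<close>: unconditional convergence of \<open>\<Sum> g\<^sub>n\<close>
  forces \<open>\<Sum> \<parallel>g\<^sub>n\<parallel>\<^sup>p < \<infinity>\<close>. Since \<open>TS = id\<close> gives \<open>S\<^sup>n\<phi> = \<phi> \<circ> f\<^sup>-\<^sup>n\<close>, every \<open>\<phi>\<close> in the dense set satisfies
  \<open>\<Sum> \<parallel>\<phi> \<circ> f\<^sup>n\<parallel>\<^sup>p < \<infinity>\<close> over the integers. If \<open>\<phi>\<close> is close to the indicator of \<open>B\<close>, then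
  \<open>B' = B \<inter> {\<bar>\<phi>\<bar> \<ge> 1/2}\<close> is as required by (SC), by Markov's inequality.

  Estimates are made with \<open>\<integral> \<bar>g\<bar>\<^sup>p\<close> and \<open>\<bar>a + b\<bar>\<^sup>p \<le> 2\<^sup>p (\<bar>a\<bar>\<^sup>p + \<bar>b\<bar>\<^sup>p)\<close> instead of the norm and
  Minkowski's inequality.
\<close>

section \<open>Inequalities for powers\<close>

text \<open>The norm of the sum is at most twice the larger norm. The crude constant is harmless,
  because the estimates below only ask for finite or small integrals.\<close>

lemma norm_add_powr_le:
  fixes a b :: "'b::real_normed_vector"
  assumes "0 < p"
  shows "norm (a + b) powr p \<le> 2 powr p * (norm a powr p + norm b powr p)"
proof -
  have "norm (a + b) powr p \<le> (2 * max (norm a) (norm b)) powr p"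
    using assms norm_triangle_ineq[of a b] by (intro powr_mono2) auto
  also have "\<dots> = 2 powr p * max (norm a) (norm b) powr p"
    by (simp add: powr_mult)
  also have "\<dots> \<le> 2 powr p * (norm a powr p + norm b powr p)"
    by (intro mult_left_mono) (auto simp: max_def)
  finally show ?thesis .
qed

text \<open>Since \<open>x powr q = x * x powr (q - 1)\<close> and the second factor is monotone,
  replacing \<open>u\<close> and \<open>v\<close> by \<open>u + v\<close> in that factor only
  increases the left side.\<close>

lemma powr_superadditive:
  fixes u v q :: real
  assumes "0 \<le> u" "0 \<le> v" "1 \<le> q"
  shows "u powr q + v powr q \<le> (u + v) powr q"
proof (cases "u = 0 \<or> v = 0")
  case False
  have split: "x powr q = x * x powr (q - 1)" if "0 < x" for x
    using that by (simp add: powr_mult_base)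
  have "u * u powr (q - 1) + v * v powr (q - 1) \<le> u * (u + v) powr (q - 1) + v * (u + v) powr (q - 1)"
    using assms by (intro add_mono mult_left_mono powr_mono2) auto
  then show ?thesis
    using False assms split[of u] split[of v] split[of "u + v"] by (simp add: distrib_right)
qed (use assms in auto)

text \<open>Midpoint convexity of the power function. Convexity is applied to positive arguments; if
  one of them is zero, the claim reduces to \<open>2 * (1 / 2) powr q \<le> 1\<close>.\<close>

lemma powr_midpoint_le:
  fixes u v q :: real
  assumes "0 \<le> u" "0 \<le> v" "1 \<le> q"
  shows "2 * ((u + v) / 2) powr q \<le> u powr q + v powr q"
proof (cases "u = 0 \<or> v = 0")
  case True
  have "2 * (w / 2) powr q \<le> w powr q" if "0 \<le> w" for w
  proof -
    have "2 * (w / 2) powr q = (2 * (1 / 2) powr q) * w powr q"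
      using that powr_mult[of w "1 / 2" q] by simp
    also have "\<dots> \<le> 1 * w powr q"
      using assms powr_mono'[of 1 q "1 / 2"] by (intro mult_right_mono) auto
    finally show ?thesis by simp
  qed
  then show ?thesis using True assms by auto
next
  case False
  then have "((1 - 1 / 2) *\<^sub>R u + (1 / 2) *\<^sub>R v) powr q
      \<le> (1 - 1 / 2) * u powr q + (1 / 2) * v powr q"
    using assms by (intro convex_onD[OF powr_convex]) auto
  then show ?thesis by (simp add: field_simps)
qed

text \<open>Raise the parallelogram law to the power \<open>p / 2\<close>, which is at least 1:
  superadditivity of this power handles the left side, midpoint convexity the right side. It applies
  to the scalars because a Euclidean space is a real inner product space.\<close>

lemma clarkson_powr:
  fixes a b :: "'b::real_inner"
  assumes "2 \<le> p"
  shows "2 * (norm a powr p + norm b powr p) \<le> norm (a + b) powr p + norm (a - b) powr p"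
proof -
  have sq: "((norm c)\<^sup>2) powr (p / 2) = norm c powr p" for c :: 'b
    by (cases "c = 0") (simp_all flip: powr_numeral add: powr_powr)
  have par: "((norm (a + b))\<^sup>2 + (norm (a - b))\<^sup>2) / 2 = (norm a)\<^sup>2 + (norm b)\<^sup>2"
    by (simp add: power2_norm_eq_inner inner_add inner_diff inner_commute)
  have "norm a powr p + norm b powr p \<le> ((norm a)\<^sup>2 + (norm b)\<^sup>2) powr (p / 2)"
    using assms powr_superadditive[of "(norm a)\<^sup>2" "(norm b)\<^sup>2" "p / 2"] by (simp add: sq)
  moreover have "2 * ((norm a)\<^sup>2 + (norm b)\<^sup>2) powr (p / 2) \<le> norm (a + b) powr p + norm (a - b) powr p"
    using assms powr_midpoint_le[of "(norm (a + b))\<^sup>2" "(norm (a - b))\<^sup>2" "p / 2"]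
    by (simp only: par sq) simp
  ultimately show ?thesis by (smt (verit, best))
qed

section \<open>The space \<open>L\<^sup>p\<close>\<close>

definition lp_class ::
    "'a measure \<Rightarrow> real \<Rightarrow> ('a \<Rightarrow> 'k::{real_normed_field, euclidean_space}) \<Rightarrow> ('a \<Rightarrow> 'k) set" where
  "lp_class M p g = ae_equal M p `` {g}"

abbreviation lp_integral ::
    "'a measure \<Rightarrow> real \<Rightarrow> ('a \<Rightarrow> 'k::{real_normed_field, euclidean_space}) \<Rightarrow> real" where
  "lp_integral M p g \<equiv> (LINT x|M. norm (g x) powr p)"

locale lp_space =
  fixes M :: "'a measure" and p :: real
  assumes p_pos: "0 < p"
begin

lemma lp_measurable: "g \<in> lp_functions M p \<Longrightarrow> g \<in> borel_measurable M"
  and lp_integrable: "g \<in> lp_functions M p \<Longrightarrow> integrable M (\<lambda>x. norm (g x) powr p)"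
  by (auto simp: lp_functions_def)

lemma lp_functionsI_bound:
  fixes g :: "'a \<Rightarrow> 'k::{real_normed_field, euclidean_space}" and w :: "'a \<Rightarrow> real"
  assumes "g \<in> borel_measurable M" "integrable M w"
    and "AE x in M. norm (g x) powr p \<le> w x"
  shows "g \<in> lp_functions M p"
  unfolding lp_functions_def using assms
  by (auto intro!: Bochner_Integration.integrable_bound[where f = w])

lemma lp_zero: "(\<lambda>_. 0) \<in> lp_functions M p"
  by (simp add: lp_functions_def)

lemma lp_add:
  assumes "g \<in> lp_functions M p" "h \<in> lp_functions M p"
  shows "(\<lambda>x. g x + h x) \<in> lp_functions M p"
  using assms norm_add_powr_le[OF p_pos]
  by (intro lp_functionsI_bound[where w = "\<lambda>x. 2 powr p * (norm (g x) powr p + norm (h x) powr p)"])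
     (auto simp: lp_functions_def)

lemma lp_uminus: "g \<in> lp_functions M p \<Longrightarrow> (\<lambda>x. - g x) \<in> lp_functions M p"
  by (simp add: lp_functions_def)

lemma lp_diff:
  "g \<in> lp_functions M p \<Longrightarrow> h \<in> lp_functions M p \<Longrightarrow> (\<lambda>x. g x - h x) \<in> lp_functions M p"
  using lp_add[OF _ lp_uminus] by fastforce

lemma lp_sum:
  assumes "\<And>i. i \<in> F \<Longrightarrow> g i \<in> lp_functions M p"
  shows "(\<lambda>x. \<Sum>i\<in>F. g i x) \<in> lp_functions M p"
  using assms by (induction F rule: infinite_finite_induct) (auto simp: lp_zero lp_add)

lemma lp_integral_diff_le:
  assumes "g \<in> lp_functions M p" "h \<in> lp_functions M p"
  shows "lp_integral M p (\<lambda>x. g x - h x) \<le> 2 powr p * (lp_integral M p g + lp_integral M p h)"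
proof -
  have "lp_integral M p (\<lambda>x. g x - h x)
      \<le> (LINT x|M. 2 powr p * (norm (g x) powr p + norm (h x) powr p))"
    using assms lp_diff[OF assms] norm_add_powr_le[OF p_pos, of "g _" "- h _"]
    by (intro integral_mono) (auto simp: lp_functions_def)
  then show ?thesis using assms by (simp add: lp_integrable)
qed

section \<open>Classes modulo almost everywhere equality and the operations of
  \<open>Lp\<close>\<close>

lemma equiv_ae_equal: "equiv (lp_functions M p) (ae_equal M p)"
proof (intro equivI refl_onI symI transI)
  fix g h k assume "(g, h) \<in> ae_equal M p" "(h, k) \<in> ae_equal M p"
  then show "(g, k) \<in> ae_equal M p"
    unfolding ae_equal_def by (auto elim: eventually_elim2)
qed (auto simp: ae_equal_def elim: eventually_mono)

lemma mem_lp_class: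
  "h \<in> lp_class M p g \<longleftrightarrow>
    g \<in> lp_functions M p \<and> h \<in> lp_functions M p \<and> (AE x in M. g x = h x)"
  by (auto simp: lp_class_def ae_equal_def)

lemma lp_class_eqI:
  assumes "g \<in> lp_functions M p" "h \<in> lp_functions M p" "AE x in M. g x = h x"
  shows "lp_class M p g = lp_class M p h"
  unfolding lp_class_def using assms
  by (intro equiv_class_eq[OF equiv_ae_equal]) (simp add: ae_equal_def)

lemma lp_class_eqD:
  assumes "lp_class M p g = lp_class M p h" "h \<in> lp_functions M p"
  shows "AE x in M. g x = h x"
  using eq_equiv_class[OF assms(1)[unfolded lp_class_def] equiv_ae_equal assms(2)] by (simp add: ae_equal_def)

text \<open>The operations of \<open>Lp\<close> are unions over all representatives. This reduces
  such a union to a single representative once independence of the choice is shown.\<close>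

lemma UN_lp_class_eq:
  assumes "g \<in> lp_functions M p"
    and "\<And>g'. g' \<in> lp_functions M p \<Longrightarrow> AE x in M. g x = g' x \<Longrightarrow> P g' = P g"
  shows "(\<Union>g'\<in>lp_class M p g. P g') = P g"
proof -
  have "g \<in> lp_class M p g" using assms(1) by (simp add: mem_lp_class)
  moreover have "P g' = P g" if "g' \<in> lp_class M p g" for g'
    using that unfolding mem_lp_class by (intro assms(2)) auto
  ultimately show ?thesis by blast
qed

lemma carrier_Lp: "carrier (Lp M p) = lp_class M p ` lp_functions M p"
  by (auto simp: Lp_def quotient_def lp_class_def)

lemma zero_Lp: "\<zero>\<^bsub>Lp M p\<^esub> = lp_class M p (\<lambda>_. 0)"
  by (simp add: Lp_def lp_class_def)

lemma add_Lp:
  assumes "g \<in> lp_functions M p" "h \<in> lp_functions M p"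
  shows "lp_class M p g \<oplus>\<^bsub>Lp M p\<^esub> lp_class M p h = lp_class M p (\<lambda>x. g x + h x)"
proof -
  \<comment> \<open>Independence of the second representative is settled first, for every choice of
    the first.\<close>
  have inner: "(\<Union>h'\<in>lp_class M p h. lp_class M p (\<lambda>x. g' x + h' x)) = lp_class M p (\<lambda>x. g' x + h x)"
    if "g' \<in> lp_functions M p" for g'
    using that assms(2) by (intro UN_lp_class_eq lp_class_eqI lp_add) (auto elim: eventually_mono)
  have "lp_class M p g \<oplus>\<^bsub>Lp M p\<^esub> lp_class M p h =
      (\<Union>g'\<in>lp_class M p g. \<Union>h'\<in>lp_class M p h. lp_class M p (\<lambda>x. g' x + h' x))"
    by (simp add: Lp_def lp_class_def)
  also have "\<dots> = (\<Union>h'\<in>lp_class M p h. lp_class M p (\<lambda>x. g x + h' x))"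
  proof (rule UN_lp_class_eq[OF assms(1)])
    fix g' assume g': "g' \<in> lp_functions M p" "AE x in M. g x = g' x"
    show "(\<Union>h'\<in>lp_class M p h. lp_class M p (\<lambda>x. g' x + h' x)) =
        (\<Union>h'\<in>lp_class M p h. lp_class M p (\<lambda>x. g x + h' x))"
      unfolding inner[OF g'(1)] inner[OF assms(1)]
      using g' assms by (intro lp_class_eqI lp_add) (auto elim: eventually_mono)
  qed
  finally show ?thesis using inner[OF assms(1)] by simp
qed

text \<open>All representatives have the same norm, so the definite description in \<open>Lp\<close>
  denotes it.\<close>

lemma vnorm_Lp:
  assumes "g \<in> lp_functions M p"
  shows "vnorm (Lp M p) (lp_class M p g) = lp_norm M p g"
proof -
  have "lp_norm M p h = lp_norm M p g" if "h \<in> lp_class M p g" for h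
  proof -
    have h: "h \<in> lp_functions M p" "AE x in M. g x = h x"
      using that by (auto simp: mem_lp_class)
    note [measurable] = lp_measurable[OF assms] lp_measurable[OF h(1)]
    have "lp_integral M p h = lp_integral M p g"
      by (rule integral_cong_AE) (use h(2) in \<open>auto elim: eventually_mono\<close>)
    then show ?thesis by (simp add: lp_norm_def)
  qed
  moreover have "g \<in> lp_class M p g" using assms by (simp add: mem_lp_class)
  ultimately have "(THE r. \<exists>h\<in>lp_class M p g. r = lp_norm M p h) = lp_norm M p g"
    by (intro the_equality) blast+
  then show ?thesis by (simp add: Lp_def)
qed

text \<open>The group laws make finite sums and differences of classes computable by the general
  rules for \<open>finsum\<close> and \<open>minus_equality\<close>.\<close>

lemma abelian_group_Lp: "abelian_group (Lp M p)"
proof (rule abelian_groupI)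
  fix x assume "x \<in> carrier (Lp M p :: ('k::{real_normed_field, euclidean_space}, ('a \<Rightarrow> 'k) set) normed_space)"
  then obtain g where g: "g \<in> lp_functions M p" "x = lp_class M p g"
    by (auto simp: carrier_Lp)
  then have "lp_class M p (\<lambda>x. - g x) \<oplus>\<^bsub>Lp M p\<^esub> x = \<zero>\<^bsub>Lp M p\<^esub>"
    by (simp add: add_Lp lp_uminus zero_Lp)
  then show "\<exists>y\<in>carrier (Lp M p). y \<oplus>\<^bsub>Lp M p\<^esub> x = \<zero>\<^bsub>Lp M p\<^esub>"
    using g lp_uminus by (auto simp: carrier_Lp)
next
  fix x y assume "x \<in> carrier (Lp M p :: ('k::{real_normed_field, euclidean_space}, ('a \<Rightarrow> 'k) set) normed_space)"
    "y \<in> carrier (Lp M p :: ('k, ('a \<Rightarrow> 'k) set) normed_space)"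
  then show "x \<oplus>\<^bsub>Lp M p\<^esub> y = y \<oplus>\<^bsub>Lp M p\<^esub> x"
    by (auto simp only: carrier_Lp add_Lp add.commute)
qed (auto simp: carrier_Lp zero_Lp add_Lp lp_add lp_zero add.assoc)

lemma diff_Lp:
  fixes g h :: "'a \<Rightarrow> 'k::{real_normed_field, euclidean_space}"
  assumes g: "g \<in> lp_functions M p" and h: "h \<in> lp_functions M p"
  shows "lp_class M p g \<ominus>\<^bsub>Lp M p\<^esub> lp_class M p h = lp_class M p (\<lambda>x. g x - h x)"
proof -
  interpret abelian_group "Lp M p :: ('k, ('a \<Rightarrow> 'k) set) normed_space" by (rule abelian_group_Lp)
  have "\<ominus>\<^bsub>Lp M p\<^esub> lp_class M p h = lp_class M p (\<lambda>x. - h x)"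
    using h by (intro minus_equality) (auto simp: add_Lp lp_uminus zero_Lp carrier_Lp)
  then show ?thesis
    using g h by (simp add: a_minus_def add_Lp lp_uminus)
qed

lemma finsum_Lp:
  fixes g :: "'i \<Rightarrow> 'a \<Rightarrow> 'k::{real_normed_field, euclidean_space}"
  assumes "finite F" "\<And>i. i \<in> F \<Longrightarrow> g i \<in> lp_functions M p"
  shows "finsum (Lp M p) (\<lambda>i. lp_class M p (g i)) F = lp_class M p (\<lambda>x. \<Sum>i\<in>F. g i x)"
proof -
  interpret abelian_group "Lp M p :: ('k, ('a \<Rightarrow> 'k) set) normed_space" by (rule abelian_group_Lp)
  show ?thesis
    using assms
  proof (induction F)
    case empty
    then show ?case by (simp add: zero_Lp)
  next
    case (insert i F)
    then have "finsum (Lp M p) (\<lambda>i. lp_class M p (g i)) (insert i F) =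
        lp_class M p (g i) \<oplus>\<^bsub>Lp M p\<^esub> lp_class M p (\<lambda>x. \<Sum>i\<in>F. g i x)"
      by (subst finsum_insert) (auto simp: carrier_Lp)
    with insert show ?case by (simp add: add_Lp lp_sum)
  qed
qed

section \<open>Density and unconditional convergence expressed by integrals\<close>

lemma lp_norm_less_iff:
  assumes "0 < e"
  shows "lp_norm M p g < e \<longleftrightarrow> lp_integral M p g < e powr p"
proof -
  have "lp_norm M p g < e \<longleftrightarrow> lp_norm M p g powr p < e powr p"
  proof
    show "lp_norm M p g < e" if "lp_norm M p g powr p < e powr p"
      using that assms p_pos powr_less_cancel2[of p "lp_norm M p g" e] powr_ge_zero
      by (cases "lp_norm M p g = 0") (auto simp: lp_norm_def)
  qed (use p_pos in \<open>auto simp: lp_norm_def intro!: powr_less_mono2\<close>)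
  also have "lp_norm M p g powr p = lp_integral M p g"
    using p_pos by (simp add: lp_norm_def powr_powr)
  finally show ?thesis .
qed

text \<open>As \<open>e\<close> runs through the positive numbers, so does \<open>e powr p\<close>;
  hence the integral can replace its \<open>p\<close>-th root, the norm.\<close>

lemma dense_in_Lp_iff:
  "dense_in (Lp M p) (lp_class M p ` D) \<longleftrightarrow>
    (\<forall>g\<in>lp_functions M p. \<forall>e>0. \<exists>h\<in>D. lp_integral M p (\<lambda>x. g x - h x) < e)"
  if D: "D \<subseteq> lp_functions M p"
proof -
  have *: "vnorm (Lp M p) (lp_class M p g \<ominus>\<^bsub>Lp M p\<^esub> lp_class M p h) < e \<longleftrightarrow>
      lp_integral M p (\<lambda>x. g x - h x) < e powr p"
    if "g \<in> lp_functions M p" "h \<in> D" "0 < e" for g h e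
    using that D by (subst diff_Lp) (auto simp: vnorm_Lp lp_diff lp_norm_less_iff)
  have "(\<forall>e>0. \<exists>h\<in>D. lp_integral M p (\<lambda>x. g x - h x) < e powr p) \<longleftrightarrow>
      (\<forall>e>0. \<exists>h\<in>D. lp_integral M p (\<lambda>x. g x - h x) < e)"
    (is "(\<forall>e>0. ?P (e powr p)) \<longleftrightarrow> (\<forall>e>0. ?P e)") for g
  proof (intro iffI allI impI)
    fix e :: real assume P: "\<forall>e>0. ?P (e powr p)" and "0 < e"
    then have "?P ((e powr (1 / p)) powr p)" by simp
    moreover have "(e powr (1 / p)) powr p = e"
      using \<open>0 < e\<close> p_pos by (simp add: powr_powr)
    ultimately show "?P e" by (simp only:)
  qed simp
  then show ?thesis
    unfolding dense_in_def using * image_mono[OF D, of "lp_class M p"] by (simp add: carrier_Lp)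
qed

text \<open>The norm is the power \<open>1 / p\<close> of the integral, and positive powers preserve
  and reflect convergence to 0.\<close>

lemma unconditionally_convergent_Lp_iff:
  fixes g :: "'i \<Rightarrow> 'a \<Rightarrow> 'k::{real_normed_field, euclidean_space}"
  assumes "\<And>i. i \<in> I \<Longrightarrow> g i \<in> lp_functions M p"
    and "\<And>i. i \<in> I \<Longrightarrow> A i = lp_class M p (g i)"
  shows "unconditionally_convergent (Lp M p) A I \<longleftrightarrow>
    (\<exists>s\<in>lp_functions M p.
      ((\<lambda>F. lp_integral M p (\<lambda>x. (\<Sum>i\<in>F. g i x) - s x)) \<longlongrightarrow> 0) (finite_subsets_at_top I))"
proof -
  interpret abelian_group "Lp M p :: ('k, ('a \<Rightarrow> 'k) set) normed_space" by (rule abelian_group_Lp)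
  have "((\<lambda>F. vnorm (Lp M p) (finsum (Lp M p) A F \<ominus>\<^bsub>Lp M p\<^esub> lp_class M p s)) \<longlongrightarrow> 0)
          (finite_subsets_at_top I) \<longleftrightarrow>
        ((\<lambda>F. lp_integral M p (\<lambda>x. (\<Sum>i\<in>F. g i x) - s x)) \<longlongrightarrow> 0) (finite_subsets_at_top I)"
    (is "(?v \<longlongrightarrow> 0) ?L \<longleftrightarrow> (?w \<longlongrightarrow> 0) ?L")
    if s: "s \<in> lp_functions M p" for s
  proof -
    \<comment> \<open>The computation of \<open>finsum\<close> is valid for finite subsets of
      \<open>I\<close>, and along the filter eventually every set is one.\<close>
    have ev: "\<forall>\<^sub>F F in ?L. finite F \<and> F \<subseteq> I"
      by (rule eventually_finite_subsets_at_top_weakI) simp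
    have v: "?v F = ?w F powr (1 / p)" if "finite F \<and> F \<subseteq> I" for F
    proof -
      have "finsum (Lp M p) A F = finsum (Lp M p) (\<lambda>i. lp_class M p (g i)) F"
        using that assms by (intro finsum_cong') (auto simp: carrier_Lp)
      also have "\<dots> = lp_class M p (\<lambda>x. \<Sum>i\<in>F. g i x)"
        using that assms by (intro finsum_Lp) auto
      finally have "?v F = lp_norm M p (\<lambda>x. (\<Sum>i\<in>F. g i x) - s x)"
        using that assms s by (simp add: diff_Lp vnorm_Lp lp_diff lp_sum subset_iff)
      then show ?thesis by (simp add: lp_norm_def)
    qed
    have "(?v \<longlongrightarrow> 0) ?L \<longleftrightarrow> ((\<lambda>F. ?w F powr (1 / p)) \<longlongrightarrow> 0) ?L"
      using v by (intro tendsto_cong eventually_mono[OF ev])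
    also have "\<dots> \<longleftrightarrow> (?w \<longlongrightarrow> 0) ?L"
    proof
      assume "((\<lambda>F. ?w F powr (1 / p)) \<longlongrightarrow> 0) ?L"
      then have "((\<lambda>F. (?w F powr (1 / p)) powr p) \<longlongrightarrow> 0) ?L"
        using p_pos by (intro tendsto_zero_powrI[of _ _ "\<lambda>_. p" p]) auto
      then show "(?w \<longlongrightarrow> 0) ?L" using p_pos by (simp add: powr_powr)
    next
      assume "(?w \<longlongrightarrow> 0) ?L"
      then show "((\<lambda>F. ?w F powr (1 / p)) \<longlongrightarrow> 0) ?L"
        using p_pos by (intro tendsto_zero_powrI[of _ _ "\<lambda>_. 1 / p" "1 / p"]) auto
    qed
    finally show ?thesis .
  qed
  then show ?thesis by (simp add: unconditionally_convergent_def carrier_Lp)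
qed

end

section \<open>Unconditional convergence in \<open>L\<^sup>p\<close>\<close>

text \<open>The finite sum and the series differ only by terms of index at least
  \<open>N\<close>.\<close>

lemma norm_sum_diff_suminf_le:
  fixes a :: "nat \<Rightarrow> 'b::banach"
  assumes a: "summable (\<lambda>n. norm (a n))" and F: "finite F" "{..<N} \<subseteq> F"
  shows "norm (sum a F - suminf a) \<le> (\<Sum>n. norm (a (n + N)))"
proof -
  \<comment> \<open>Beyond \<open>m\<close> no index lies in \<open>F\<close>, so the difference
    consists of the remainder from \<open>m\<close> on and the indices in \<open>{N..<m}\<close>
    that \<open>F\<close> misses.\<close>
  obtain m where m: "F \<subseteq> {..<m}" "N \<le> m"
  proof -
    obtain k where "F \<subseteq> {..<k}" using F(1) finite_nat_iff_bounded by blast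
    then show thesis by (intro that[of "max k N"]) auto
  qed
  have tail: "summable (\<lambda>n. norm (a (n + k)))" for k
    using a by (rule summable_ignore_initial_segment)
  have "suminf a = (\<Sum>n. a (n + m)) + sum a {..<m}"
    by (intro suminf_split_initial_segment summable_norm_cancel[OF a])
  moreover have "sum a {..<m} = sum a ({..<m} - F) + sum a F"
    using m(1) by (intro sum.subset_diff) auto
  ultimately have "norm (sum a F - suminf a) = norm ((\<Sum>n. a (n + m)) + sum a ({..<m} - F))"
    by (metis add.assoc add_diff_cancel_right' norm_minus_commute)
  also have "\<dots> \<le> norm (\<Sum>n. a (n + m)) + norm (sum a ({..<m} - F))"
    by (rule norm_triangle_ineq)
  also have "\<dots> \<le> (\<Sum>n. norm (a (n + m))) + (\<Sum>n\<in>{N..<m}. norm (a n))"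
  proof (intro add_mono summable_norm[OF tail])
    have "norm (sum a ({..<m} - F)) \<le> (\<Sum>n\<in>{..<m} - F. norm (a n))" by (rule norm_sum)
    also have "\<dots> \<le> (\<Sum>n\<in>{N..<m}. norm (a n))"
      using F(2) by (intro sum_mono2) (auto simp: not_less[symmetric])
    finally show "norm (sum a ({..<m} - F)) \<le> (\<Sum>n\<in>{N..<m}. norm (a n))" .
  qed
  also have "\<dots> = (\<Sum>n. norm (a (n + N)))"
  proof -
    have "(\<Sum>n\<in>{N..<m}. norm (a n)) = (\<Sum>n<m - N. norm (a (n + N)))"
      using m(2) by (intro sum.reindex_bij_witness[of _ "\<lambda>n. n + N" "\<lambda>n. n - N"]) auto
    then show ?thesis
      using suminf_split_initial_segment[OF tail[of N], of "m - N"] m(2) by (simp add: add.assoc)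
  qed
  finally show ?thesis .
qed

context lp_space
begin

lemma dominated_lp_functions:
  fixes g :: "'a \<Rightarrow> 'k::{real_normed_field, euclidean_space}" and h :: "'a \<Rightarrow> real"
  assumes "g \<in> borel_measurable M" "integrable M (\<lambda>x. h x powr p)"
    and "\<And>x. x \<in> space M \<Longrightarrow> norm (g x) \<le> h x"
  shows "g \<in> lp_functions M p"
  using assms p_pos
  by (intro lp_functionsI_bound[where w = "\<lambda>x. h x powr p"]) (auto intro!: AE_I2 powr_mono2)

text \<open>The remainder \<open>W N\<close> of the absolute series is dominated by \<open>h\<close>
  and tends to 0 pointwise, so the integrals of its \<open>p\<close>-th power tend to 0. It bounds
  the error of every finite partial sum containing the indices of \<open>I\<close> below
  \<open>N\<close>.\<close>

lemma dominated_unconditionally_convergent: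
  fixes g :: "nat \<Rightarrow> 'a \<Rightarrow> 'k::{real_normed_field, euclidean_space}" and h :: "'a \<Rightarrow> real"
  assumes g: "\<And>n. n \<in> I \<Longrightarrow> g n \<in> borel_measurable M"
    and h: "integrable M (\<lambda>x. h x powr p)"
    and dom: "\<And>x J. x \<in> space M \<Longrightarrow> finite J \<Longrightarrow> J \<subseteq> I \<Longrightarrow> (\<Sum>n\<in>J. norm (g n x)) \<le> h x"
  shows "\<exists>s\<in>lp_functions M p.
    ((\<lambda>F. lp_integral M p (\<lambda>x. (\<Sum>n\<in>F. g n x) - s x)) \<longlongrightarrow> 0) (finite_subsets_at_top I)"
proof -
  \<comment> \<open>Extension by zero outside \<open>I\<close> turns the family into an ordinary
    series.\<close>
  define a where "a n x = (if n \<in> I then g n x else 0)" for n x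
  have [measurable]: "a n \<in> borel_measurable M" for n
    using g[of n] by (cases "n \<in> I") (auto simp: a_def[abs_def])
  have a_sum: "(\<Sum>n\<in>F. a n x) = (\<Sum>n\<in>F \<inter> I. g n x)"
      "(\<Sum>n\<in>F. norm (a n x)) = (\<Sum>n\<in>F \<inter> I. norm (g n x))" if "finite F" for F x
    using that by (auto simp: a_def sum.inter_restrict if_distrib cong: if_cong)
  have a_le: "(\<Sum>n\<in>F. norm (a n x)) \<le> h x" if "finite F" "x \<in> space M" for F x
    using that dom[of x "F \<inter> I"] by (simp add: a_sum)
  have a_summable: "summable (\<lambda>n. norm (a n x))" if "x \<in> space M" for x
    using a_le[OF _ that] by (intro summableI_nonneg_bounded[where x = "h x"]) auto
  define s where "s x = (\<Sum>n. a n x)" for x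
  define W where "W N x = (\<Sum>n. norm (a (n + N) x))" for N x
  have W_split: "W 0 x = W N x + (\<Sum>n<N. norm (a n x))" if "x \<in> space M" for N x
    using suminf_split_initial_segment[OF a_summable[OF that]] by (simp add: W_def)
  have W0_le: "W 0 x \<le> h x" if "x \<in> space M" for x
    using a_le[OF _ that] suminf_le_const[OF a_summable[OF that]] by (simp add: W_def)
  have W_nonneg: "0 \<le> W N x" if "x \<in> space M" for N x
    unfolding W_def by (intro suminf_nonneg summable_ignore_initial_segment a_summable that) auto
  have W_le: "W N x \<le> h x" if "x \<in> space M" for N x
    using W_split[OF that, of N] W0_le[OF that] sum_nonneg[of "{..<N}" "\<lambda>n. norm (a n x)"] by simp
  have W_lim: "(\<lambda>N. W N x) \<longlonglongrightarrow> 0" if "x \<in> space M" for x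
  proof -
    have "(\<lambda>N. W 0 x - (\<Sum>n<N. norm (a n x))) \<longlonglongrightarrow> W 0 x - (\<Sum>n. norm (a n x))"
      by (intro tendsto_intros summable_LIMSEQ a_summable that)
    moreover have "W 0 x - (\<Sum>n<N. norm (a n x)) = W N x" for N
      using W_split[OF that, of N] by simp
    ultimately show ?thesis by (simp add: W_def)
  qed
  have [measurable]: "s \<in> borel_measurable M" "W N \<in> borel_measurable M" for N
    unfolding s_def W_def by measurable
  have s: "s \<in> lp_functions M p"
  proof (rule dominated_lp_functions[OF _ h])
    show "norm (s x) \<le> h x" if "x \<in> space M" for x
      using summable_norm[OF a_summable[OF that]] W0_le[OF that] by (simp add: s_def W_def)
  qed simp
  have W_int: "integrable M (\<lambda>x. W N x powr p)" for N
    using W_le W_nonneg p_pos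
    by (intro Bochner_Integration.integrable_bound[OF h]) (auto intro!: AE_I2 powr_mono2)
  have "(\<lambda>N. LINT x|M. W N x powr p) \<longlonglongrightarrow> (LINT x|M. 0)"
  proof (rule integral_dominated_convergence[OF _ _ h])
    show "AE x in M. (\<lambda>N. W N x powr p) \<longlonglongrightarrow> 0"
      using W_lim W_nonneg p_pos
      by (intro AE_I2 tendsto_zero_powrI[of _ _ "\<lambda>_. p" p]) auto
    show "AE x in M. norm (W N x powr p) \<le> h x powr p" for N
      using W_le W_nonneg p_pos by (auto intro!: AE_I2 powr_mono2)
  qed auto
  then have W_int_lim: "(\<lambda>N. LINT x|M. W N x powr p) \<longlonglongrightarrow> 0" by simp
  have "\<forall>\<^sub>F F in finite_subsets_at_top I.
      dist (lp_integral M p (\<lambda>x. (\<Sum>n\<in>F. g n x) - s x)) 0 < e" if "0 < e" for e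
  proof -
    obtain N where N: "(LINT x|M. W N x powr p) < e"
      using order_tendstoD(2)[OF W_int_lim \<open>0 < e\<close>] by (auto simp: eventually_sequentially)
    have "lp_integral M p (\<lambda>x. (\<Sum>n\<in>F. g n x) - s x) < e"
      if F: "finite F" "{..<N} \<inter> I \<subseteq> F" "F \<subseteq> I" for F
    proof -
      have le: "norm ((\<Sum>n\<in>F. g n x) - s x) \<le> W N x" if "x \<in> space M" for x
      proof -
        \<comment> \<open>Indices below \<open>N\<close> outside \<open>I\<close> contribute zero;
          adding them makes the index set contain a full initial segment.\<close>
        have "(\<Sum>n\<in>F. g n x) = (\<Sum>n\<in>F \<union> {..<N}. a n x)"
          using F by (subst a_sum) (auto intro!: sum.cong)
        then show ?thesis
          unfolding s_def W_def
          using norm_sum_diff_suminf_le[OF a_summable[OF that], of "F \<union> {..<N}" N] F by simp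
      qed
      have "g n \<in> lp_functions M p" if "n \<in> F" for n
        using dom[of _ "{n}"] that F by (intro dominated_lp_functions[OF g h]) auto
      then have "lp_integral M p (\<lambda>x. (\<Sum>n\<in>F. g n x) - s x) \<le> (LINT x|M. W N x powr p)"
        using le p_pos by (intro integral_mono lp_integrable lp_diff lp_sum s W_int powr_mono2) auto
      with N show ?thesis by simp
    qed
    then show ?thesis
      unfolding eventually_finite_subsets_at_top
      by (intro exI[of _ "{..<N} \<inter> I"]) auto
  qed
  then show ?thesis using s by (intro bexI[of _ s] tendstoI)
qed

text \<open>The choice of \<open>E\<close> amounts to a choice of signs. The signs are fixed one after the other:
  by Clarkson's inequality one of the two possible signs of the next term is good.\<close>

lemma exists_signs_lp_integral_ge:
  fixes g :: "'i \<Rightarrow> 'a \<Rightarrow> 'k::{real_normed_field, euclidean_space}"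
  assumes "2 \<le> p" "finite F" "\<And>i. i \<in> F \<Longrightarrow> g i \<in> lp_functions M p"
  shows "\<exists>E\<subseteq>F. (\<Sum>i\<in>F. lp_integral M p (g i)) \<le>
    lp_integral M p (\<lambda>x. (\<Sum>i\<in>E. g i x) - (\<Sum>i\<in>F - E. g i x))"
  using assms(2,3)
proof (induction F)
  case (insert j F)
  then obtain E where E: "E \<subseteq> F"
    "(\<Sum>i\<in>F. lp_integral M p (g i)) \<le> lp_integral M p (\<lambda>x. (\<Sum>i\<in>E. g i x) - (\<Sum>i\<in>F - E. g i x))"
    by auto
  define u where "u x = (\<Sum>i\<in>E. g i x) - (\<Sum>i\<in>F - E. g i x)" for x
  have u: "u \<in> lp_functions M p" and g: "g j \<in> lp_functions M p"
    unfolding u_def[abs_def] using insert.prems E(1) by (auto intro!: lp_diff lp_sum)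
  have "(LINT x|M. 2 * (norm (u x) powr p + norm (g j x) powr p))
      \<le> (LINT x|M. norm (u x + g j x) powr p + norm (u x - g j x) powr p)"
    using u g clarkson_powr[OF assms(1)]
    by (intro integral_mono integrable_mult_right Bochner_Integration.integrable_add lp_integrable lp_add lp_diff)
  then have "2 * (lp_integral M p u + lp_integral M p (g j))
      \<le> lp_integral M p (\<lambda>x. u x + g j x) + lp_integral M p (\<lambda>x. u x - g j x)"
    using u g by (simp add: lp_integrable lp_integrable[OF lp_add] lp_integrable[OF lp_diff])
  moreover have "(\<Sum>i\<in>insert j F. lp_integral M p (g i)) \<le> lp_integral M p u + lp_integral M p (g j)"
    using insert.hyps E(2) by (simp add: u_def)
  ultimately have
    "(\<Sum>i\<in>insert j F. lp_integral M p (g i)) \<le> lp_integral M p (\<lambda>x. u x + g j x) \<or>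
     (\<Sum>i\<in>insert j F. lp_integral M p (g i)) \<le> lp_integral M p (\<lambda>x. u x - g j x)"
    by (smt (verit))
  then show ?case
  proof
    \<comment> \<open>The plus sign puts \<open>j\<close> into \<open>E\<close>; in the other case
      the minus sign leaves \<open>j\<close> in the complement.\<close>
    assume *: "(\<Sum>i\<in>insert j F. lp_integral M p (g i)) \<le> lp_integral M p (\<lambda>x. u x + g j x)"
    have "finite E" "j \<notin> E" "insert j F - insert j E = F - E"
      using insert.hyps E(1) finite_subset by auto
    with * show ?thesis
      using E(1) by (intro exI[of _ "insert j E"]) (auto simp: u_def algebra_simps)
  next
    assume *: "(\<Sum>i\<in>insert j F. lp_integral M p (g i)) \<le> lp_integral M p (\<lambda>x. u x - g j x)"
    have "insert j F - E = insert j (F - E)" "j \<notin> F - E" "finite (F - E)"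
      using insert.hyps E(1) by auto
    with * show ?thesis
      using E(1) by (intro exI[of _ E]) (auto simp: u_def algebra_simps)
  qed
qed simp

text \<open>Cotype \<open>p\<close>: convergence bounds the partial sums over all finite sets
  disjoint from some finite \<open>F0\<close>, and the choice of signs turns this into a bound for
  the sum of the integrals. The indices in \<open>F0\<close> add a constant.\<close>

lemma unconditionally_convergent_imp_sum_bounded:
  fixes g :: "'i \<Rightarrow> 'a \<Rightarrow> 'k::{real_normed_field, euclidean_space}"
  assumes p: "2 \<le> p" and g: "\<And>i. i \<in> I \<Longrightarrow> g i \<in> lp_functions M p" and s: "s \<in> lp_functions M p"
    and lim: "((\<lambda>F. lp_integral M p (\<lambda>x. (\<Sum>i\<in>F. g i x) - s x)) \<longlongrightarrow> 0) (finite_subsets_at_top I)"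
  shows "\<exists>C. \<forall>F. finite F \<longrightarrow> F \<subseteq> I \<longrightarrow> (\<Sum>i\<in>F. lp_integral M p (g i)) \<le> C"
proof -
  obtain F0 where F0: "finite F0" "F0 \<subseteq> I"
    and near: "\<And>F. finite F \<Longrightarrow> F0 \<subseteq> F \<Longrightarrow> F \<subseteq> I \<Longrightarrow>
      lp_integral M p (\<lambda>x. (\<Sum>i\<in>F. g i x) - s x) < 1"
    using order_tendstoD(2)[OF lim zero_less_one] by (auto simp: eventually_finite_subsets_at_top)
  have partial: "lp_integral M p (\<lambda>x. \<Sum>i\<in>F. g i x) \<le> 2 powr p * 2"
    if F: "finite F" "F \<subseteq> I" "F \<inter> F0 = {}" for F
  proof -
    have mem: "(\<lambda>x. (\<Sum>i\<in>G. g i x) - s x) \<in> lp_functions M p" if "G \<subseteq> I" for G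
      using that g s by (auto intro!: lp_diff lp_sum)
    \<comment> \<open>A block disjoint from \<open>F0\<close> is a difference of two partial sums
      over sets containing \<open>F0\<close>, and both are close to \<open>s\<close>.\<close>
    have "(\<Sum>i\<in>F. g i x) = ((\<Sum>i\<in>F \<union> F0. g i x) - s x) - ((\<Sum>i\<in>F0. g i x) - s x)" for x
      using F F0(1) by (simp add: sum.union_disjoint)
    then have "lp_integral M p (\<lambda>x. \<Sum>i\<in>F. g i x) =
        lp_integral M p (\<lambda>x. ((\<Sum>i\<in>F \<union> F0. g i x) - s x) - ((\<Sum>i\<in>F0. g i x) - s x))"
      by simp
    also have "\<dots> \<le> 2 powr p * (lp_integral M p (\<lambda>x. (\<Sum>i\<in>F \<union> F0. g i x) - s x) +
        lp_integral M p (\<lambda>x. (\<Sum>i\<in>F0. g i x) - s x))"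
      using F F0 by (intro lp_integral_diff_le mem) auto
    also have "\<dots> \<le> 2 powr p * (1 + 1)"
      using near[of "F \<union> F0"] near[of F0] F F0 by (intro mult_left_mono add_mono) auto
    finally show ?thesis by simp
  qed
  have far: "(\<Sum>i\<in>F. lp_integral M p (g i)) \<le> 2 powr p * (2 powr p * 2 + 2 powr p * 2)"
    if F: "finite F" "F \<subseteq> I" "F \<inter> F0 = {}" for F
  proof -
    \<comment> \<open>Both \<open>E\<close> and \<open>F - E\<close> avoid \<open>F0\<close>, so
      \<open>partial\<close> bounds each half of the signed sum.\<close>
    obtain E where E: "E \<subseteq> F" "(\<Sum>i\<in>F. lp_integral M p (g i)) \<le>
        lp_integral M p (\<lambda>x. (\<Sum>i\<in>E. g i x) - (\<Sum>i\<in>F - E. g i x))"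
      using exists_signs_lp_integral_ge[OF p F(1), of g] F(2) g by (auto simp: subset_iff)
    note E(2)
    also have "\<dots> \<le> 2 powr p * (lp_integral M p (\<lambda>x. \<Sum>i\<in>E. g i x) + lp_integral M p (\<lambda>x. \<Sum>i\<in>F - E. g i x))"
      using E(1) F g by (intro lp_integral_diff_le lp_sum) auto
    also have "\<dots> \<le> 2 powr p * (2 powr p * 2 + 2 powr p * 2)"
      using E(1) F finite_subset by (intro mult_left_mono add_mono partial) auto
    finally show ?thesis .
  qed
  have "(\<Sum>i\<in>F. lp_integral M p (g i)) \<le>
      2 powr p * (2 powr p * 2 + 2 powr p * 2) + (\<Sum>i\<in>F0. lp_integral M p (g i))"
    if F: "finite F" "F \<subseteq> I" for F
  proof -
    have "(\<Sum>i\<in>F. lp_integral M p (g i)) =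
        (\<Sum>i\<in>F - F0. lp_integral M p (g i)) + (\<Sum>i\<in>F \<inter> F0. lp_integral M p (g i))"
      using F(1) by (metis add.commute sum.Int_Diff)
    also have "(\<Sum>i\<in>F \<inter> F0. lp_integral M p (g i)) \<le> (\<Sum>i\<in>F0. lp_integral M p (g i))"
      using F0(1) by (intro sum_mono2) auto
    also have "(\<Sum>i\<in>F - F0. lp_integral M p (g i)) \<le> 2 powr p * (2 powr p * 2 + 2 powr p * 2)"
      using F by (intro far) auto
    finally show ?thesis by simp
  qed
  then show ?thesis by blast
qed

end

section \<open>Composition operators and iterates\<close>

context lp_space
begin

text \<open>Markov's inequality for \<open>norm (g x) powr p\<close> at the level
  \<open>c powr p\<close>.\<close>

lemma emeasure_le_lp_integral:
  fixes g :: "'a \<Rightarrow> 'k::{real_normed_field, euclidean_space}"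
  assumes g: "g \<in> lp_functions M p" and "A \<in> sets M" "0 < c"
    and le: "\<And>x. x \<in> A \<Longrightarrow> c \<le> norm (g x)"
  shows "emeasure M A \<le> ennreal (lp_integral M p g / c powr p)"
proof -
  have "emeasure M A = (\<integral>\<^sup>+x. indicator A x \<partial>M)"
    using assms(2) by simp
  also have "\<dots> \<le> (\<integral>\<^sup>+x. ennreal (norm (g x) powr p / c powr p) \<partial>M)"
  proof (intro nn_integral_mono)
    fix x
    have "1 \<le> norm (g x) powr p / c powr p" if "x \<in> A"
      using le[OF that] \<open>0 < c\<close> p_pos by (auto intro: powr_mono2)
    then show "indicator A x \<le> ennreal (norm (g x) powr p / c powr p)"
      by (auto split: split_indicator)
  qed
  also have "\<dots> = ennreal (LINT x|M. norm (g x) powr p / c powr p)"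
    using lp_integrable[OF g] by (intro nn_integral_eq_integral) auto
  finally show ?thesis by simp
qed

lemma lp_functions_cong_AE:
  assumes "g \<in> lp_functions M p" "h \<in> borel_measurable M" "AE x in M. g x = h x"
  shows "h \<in> lp_functions M p"
  using assms(3)
  by (intro lp_functionsI_bound[OF assms(2) lp_integrable[OF assms(1)]]) (auto elim: eventually_mono)

text \<open>Nonsingularity of \<open>k\<close>, in the form of the assumption on \<open>AE\<close>,
  makes the class of \<open>g \<circ> k\<close> independent of the representative. The map
  \<open>k\<close> is general so as to cover both \<open>f\<close> and its inverse.\<close>

lemma composition_operator_lp_class:
  assumes k: "k \<in> measurable M M" "\<And>P. AE x in M. P x \<Longrightarrow> AE x in M. P (k x)"
    and g: "g \<in> lp_functions M p" "g \<circ> k \<in> lp_functions M p"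
  shows "composition_operator M p k (lp_class M p g) = lp_class M p (g \<circ> k)"
proof -
  have "(\<Union>g'\<in>lp_class M p g. lp_class M p (g' \<circ> k)) = lp_class M p (g \<circ> k)"
  proof (rule UN_lp_class_eq[OF g(1)])
    fix g' assume g': "g' \<in> lp_functions M p" "AE x in M. g x = g' x"
    have AE: "AE x in M. (g \<circ> k) x = (g' \<circ> k) x"
      using k(2)[OF g'(2)] by simp
    moreover have "g' \<circ> k \<in> lp_functions M p"
      by (rule lp_functions_cong_AE[OF g(2) _ AE]) (use k(1) lp_measurable[OF g'(1)] in \<open>rule measurable_comp\<close>)
    ultimately show "lp_class M p (g' \<circ> k) = lp_class M p (g \<circ> k)"
      using g(2) by (intro lp_class_eqI) (auto elim: eventually_mono)
  qed
  then show ?thesis by (simp add: composition_operator_def lp_class_def)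
qed

lemma composition_operator_funpow_lp_class:
  assumes "k \<in> measurable M M" "\<And>P. AE x in M. P x \<Longrightarrow> AE x in M. P (k x)"
    and "\<And>n. g \<circ> k ^^ n \<in> lp_functions M p"
  shows "(composition_operator M p k ^^ n) (lp_class M p g) = lp_class M p (g \<circ> k ^^ n)"
proof (induction n)
  case (Suc n)
  have eq: "g \<circ> k ^^ Suc n = (g \<circ> k ^^ n) \<circ> k"
    by (simp only: funpow_Suc_right comp_assoc)
  have "(composition_operator M p k ^^ Suc n) (lp_class M p g) =
      composition_operator M p k (lp_class M p (g \<circ> k ^^ n))"
    unfolding Suc[symmetric] by simp
  also have "\<dots> = lp_class M p ((g \<circ> k ^^ n) \<circ> k)"
    by (intro composition_operator_lp_class assms assms(3)[of "Suc n", unfolded eq])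
  finally show ?case unfolding eq .
qed simp

end

section \<open>Null sets and integer iterates of the system\<close>

context measurable_system
begin

abbreviation f_inv :: "'a \<Rightarrow> 'a" where
  "f_inv \<equiv> inv_into (space M) f"

abbreviation iter :: "int \<Rightarrow> 'a \<Rightarrow> 'a" where
  "iter \<equiv> int_iterate (space M) f"

lemma f_space: "x \<in> space M \<Longrightarrow> f x \<in> space M"
  using measurable_f by (rule measurable_space)

lemma f_inv_f: "x \<in> space M \<Longrightarrow> f_inv (f x) = x"
  using bij by (rule bij_betw_inv_into_left)

lemma f_f_inv: "x \<in> space M \<Longrightarrow> f (f_inv x) = x"
  using bij by (rule bij_betw_inv_into_right)

lemma f_inv_space: "x \<in> space M \<Longrightarrow> f_inv x \<in> space M"
  by (metis bij bij_betw_def inv_into_into)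

lemma vimage_f_inv: "B \<in> sets M \<Longrightarrow> f_inv -` B \<inter> space M = f ` B"
  using sets.sets_into_space[of B M] f_space f_inv_f f_f_inv
  by (auto simp: image_iff subset_iff) metis

lemma measurable_f_inv: "f_inv \<in> measurable M M"
  by (rule measurableI) (auto simp: vimage_f_inv image_sets f_inv_space)

lemma AE_f:
  assumes "AE x in M. P x"
  shows "AE x in M. P (f x)"
proof -
  obtain N where N: "N \<in> null_sets M" "{x \<in> space M. \<not> P x} \<subseteq> N"
    using assms unfolding eventually_ae_filter by auto
  then have "f -` N \<inter> space M \<in> null_sets M"
    using nonsingular[of N] measurable_sets[OF measurable_f] by (auto simp: null_sets_def)
  moreover have "{x \<in> space M. \<not> P (f x)} \<subseteq> f -` N \<inter> space M"
    using N(2) f_space by auto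
  ultimately show ?thesis unfolding eventually_ae_filter by blast
qed

text \<open>This uses the other direction of nonsingularity: the image of \<open>N\<close> under
  \<open>f\<close> has preimage \<open>N\<close>, so it is null.\<close>

lemma AE_f_inv:
  assumes "AE x in M. P x"
  shows "AE x in M. P (f_inv x)"
proof -
  obtain N where N: "N \<in> null_sets M" "{x \<in> space M. \<not> P x} \<subseteq> N"
    using assms unfolding eventually_ae_filter by auto
  then have "N \<subseteq> space M" using sets.sets_into_space by (auto simp: null_sets_def)
  then have "f -` (f ` N) \<inter> space M = N"
    using f_inv_f by (auto simp: subset_iff) metis
  then have "f ` N \<in> null_sets M"
    using nonsingular[of "f ` N"] N(1) image_sets by (auto simp: null_sets_def)
  moreover have "{x \<in> space M. \<not> P (f_inv x)} \<subseteq> f ` N"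
  proof
    fix x assume "x \<in> {x \<in> space M. \<not> P (f_inv x)}"
    then have "x \<in> space M" "f_inv x \<in> N" using N(2) f_inv_space by auto
    then show "x \<in> f ` N" using f_f_inv[of x] by (intro image_eqI) auto
  qed
  ultimately show ?thesis unfolding eventually_ae_filter by blast
qed

lemma AE_f_inv_funpow:
  assumes "AE x in M. P x"
  shows "AE x in M. P ((f_inv ^^ n) x)"
proof (induction n)
  case (Suc n)
  from AE_f_inv[OF Suc] show ?case by (simp add: funpow_swap1)
qed (use assms in simp)

lemma iter_nat: "iter (int n) = f ^^ n"
  and iter_neg: "iter (- int n) = f_inv ^^ n"
  by (auto simp: int_iterate_def)

lemma iter_0: "iter 0 = id"
  by (simp add: int_iterate_def)

lemma iter_space: "x \<in> space M \<Longrightarrow> iter n x \<in> space M"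
proof -
  have "(f ^^ k) x \<in> space M" "(f_inv ^^ k) x \<in> space M" if "x \<in> space M" for k
    by (induction k) (use that f_space f_inv_space in auto)
  then show "x \<in> space M \<Longrightarrow> iter n x \<in> space M" by (simp add: int_iterate_def)
qed

lemma measurable_iter: "iter n \<in> measurable M M"
proof -
  have "f ^^ k \<in> measurable M M" "f_inv ^^ k \<in> measurable M M" for k
    by (induction k) (auto intro: measurable_comp measurable_f measurable_f_inv simp: id_def)
  then show ?thesis by (simp add: int_iterate_def)
qed

lemma iter_f:
  assumes "x \<in> space M"
  shows "iter n (f x) = iter (n + 1) x"
proof (cases n rule: int_cases2)
  case (nonneg k)
  then show ?thesis using iter_nat[of k] iter_nat[of "Suc k"] by (simp add: funpow_swap1 add.commute)
next
  case (nonpos k)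
  show ?thesis
  proof (cases k)
    case 0
    then show ?thesis using nonpos iter_nat[of 1] by (simp add: iter_0)
  next
    case (Suc j)
    then have "n + 1 = - int j" using nonpos by simp
    then show ?thesis
      using nonpos Suc iter_neg[of k] iter_neg[of j] f_inv_f[OF assms] by (simp add: funpow_swap1)
  qed
qed

lemma iter_f_inv: "x \<in> space M \<Longrightarrow> iter n (f_inv x) = iter (n - 1) x"
  using iter_f[of "f_inv x" "n - 1"] by (simp add: f_inv_space f_f_inv)

text \<open>On the space the iterates form an action of the integers. The induction on
  \<open>m\<close>, upwards and downwards from 0, absorbs one step into the point, which therefore
  varies.\<close>

lemma iter_add:
  "x \<in> space M \<Longrightarrow> iter n (iter m x) = iter (n + m) x"
proof (induction m arbitrary: x rule: int_induct[where k = 0])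
  case (step1 m)
  then have "iter n (iter (m + 1) x) = iter n (iter m (f x))" by (simp only: iter_f)
  also have "\<dots> = iter (n + m + 1) x" 
    using step1.IH[OF f_space[OF step1.prems]] iter_f[OF step1.prems, of "n + m"] by simp
  finally show ?case by (simp add: add.assoc)
next
  case (step2 m)
  then have "iter n (iter (m - 1) x) = iter n (iter m (f_inv x))" by (simp only: iter_f_inv)
  also have "\<dots> = iter (n + m - 1) x" 
    using step2.IH[OF f_inv_space[OF step2.prems]] iter_f_inv[OF step2.prems, of "n + m"] by simp
  finally show ?case by (simp add: add_diff_eq)
qed (simp add: iter_0)

lemma image_iter:
  assumes "B \<in> sets M"
  shows "iter n ` B = iter (- n) -` B \<inter> space M"
  using sets.sets_into_space[OF assms] iter_add[of _ n "- n"] iter_add[of _ "- n" n] iter_space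
  by (auto simp: iter_0 image_iff subset_iff) (metis id_apply)

text \<open>The distortion bound says that the image measure of \<open>M\<close> under
  \<open>f\<close> is at most \<open>c\<close> times \<open>M\<close>, and integrals of nonnegative
  functions are monotone in the measure.\<close>

lemma lp_comp_f:
  fixes g :: "'a \<Rightarrow> 'k::{real_normed_field, euclidean_space}"
  assumes "g \<in> lp_functions M p"
  shows "g \<circ> f \<in> lp_functions M p"
proof -
  obtain c :: real where c: "\<And>B. B \<in> sets M \<Longrightarrow> emeasure M (f -` B \<inter> space M) \<le> ennreal c * emeasure M B"
    using bounded_distortion by blast
  have g: "g \<in> borel_measurable M" "integrable M (\<lambda>x. norm (g x) powr p)"
    using assms by (auto simp: lp_functions_def)
  have le: "distr M M f \<le> scale_measure (ennreal c) M"
    using c by (subst le_measure) (auto simp: emeasure_distr[OF measurable_f])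
  have "(\<integral>\<^sup>+x. norm (g (f x)) powr p \<partial>M) = (\<integral>\<^sup>+x. norm (g x) powr p \<partial>distr M M f)"
    using g(1) by (subst nn_integral_distr[OF measurable_f]) auto
  also have "\<dots> \<le> (\<integral>\<^sup>+x. norm (g x) powr p \<partial>scale_measure (ennreal c) M)"
    using le by (intro nn_integral_mono_measure) auto
  also have "\<dots> = ennreal c * (\<integral>\<^sup>+x. norm (g x) powr p \<partial>M)"
    using g(1) by (subst nn_integral_scale_measure) auto
  also have "\<dots> < \<infinity>"
    using g(2) by (simp add: nn_integral_eq_integral ennreal_mult_less_top)
  finally show ?thesis
    using g(1) measurable_f by (auto simp: lp_functions_def comp_def intro!: integrableI_bounded)
qed

lemma lp_comp_funpow_f:
  fixes g :: "'a \<Rightarrow> 'k::{real_normed_field, euclidean_space}"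
  assumes "g \<in> lp_functions M p"
  shows "g \<circ> f ^^ n \<in> lp_functions M p"
proof (induction n)
  case (Suc n)
  from lp_comp_f[OF Suc] show ?case by (simp only: funpow_Suc_right comp_assoc)
qed (use assms in simp)

end

section \<open>From the criterion to the summability condition\<close>

context measurable_system
begin

lemma vimage_iter_sets: "B \<in> sets M \<Longrightarrow> iter n -` B \<inter> space M \<in> sets M"
  using measurable_iter by (rule measurable_sets)

lemma f_inv_funpow_f_funpow: "x \<in> space M \<Longrightarrow> (f ^^ n) ((f_inv ^^ n) x) = x"
  using iter_add[of x "int n" "- int n"] by (simp only: iter_nat iter_neg) (simp add: iter_0)

text \<open>This identifies the powers of the unknown map \<open>S\<close>: a representative
  \<open>\<psi>\<close> of the \<open>n\<close>-th power applied to \<open>\<phi>\<close> must be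
  \<open>\<phi> \<circ> f_inv ^^ n\<close> almost everywhere. Membership in
  \<open>lp_functions M p\<close> is part of the conclusion because the distortion bound controls
  composition with \<open>f\<close> only.\<close>

lemma lp_integral_right_inverse:
  fixes \<phi> \<psi> :: "'a \<Rightarrow> 'k::{real_normed_field, euclidean_space}"
  assumes "0 < p" and \<phi>: "\<phi> \<in> lp_functions M p" and \<psi>: "\<psi> \<in> lp_functions M p"
    and "lp_class M p (\<psi> \<circ> f ^^ n) = lp_class M p \<phi>"
  shows "\<phi> \<circ> f_inv ^^ n \<in> lp_functions M p \<and>
    lp_integral M p (\<phi> \<circ> f_inv ^^ n) = lp_integral M p \<psi>"
proof -
  interpret lp_space M p by unfold_locales (rule assms)
  have "AE x in M. (\<psi> \<circ> f ^^ n) x = \<phi> x"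
    using assms(4) \<phi> by (rule lp_class_eqD)
  then have "AE x in M. (\<psi> \<circ> f ^^ n) ((f_inv ^^ n) x) = \<phi> ((f_inv ^^ n) x)"
    by (rule AE_f_inv_funpow)
  then have AE: "AE x in M. \<psi> x = (\<phi> \<circ> f_inv ^^ n) x"
    using AE_space by eventually_elim (simp add: f_inv_funpow_f_funpow)
  have "f_inv ^^ n \<in> measurable M M"
    using measurable_iter[of "- int n"] by (simp add: iter_neg)
  then have *: "\<phi> \<circ> f_inv ^^ n \<in> borel_measurable M"
    using lp_measurable[OF \<phi>] by (rule measurable_comp)
  then have mem: "\<phi> \<circ> f_inv ^^ n \<in> lp_functions M p"
    by (rule lp_functions_cong_AE[OF \<psi> _ AE])
  note [measurable] = *[unfolded comp_def] lp_measurable[OF \<psi>]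
  have "lp_integral M p (\<phi> \<circ> f_inv ^^ n) = lp_integral M p \<psi>"
    by (rule integral_cong_AE) (use AE in \<open>auto elim: eventually_mono\<close>)
  with mem show ?thesis by blast
qed

lemma sum_symmetric_int_interval:
  fixes b :: "int \<Rightarrow> real"
  shows "(\<Sum>n\<in>{- int m..int m}. b n) = b 0 + (\<Sum>k\<in>{1..m}. b (int k)) + (\<Sum>k\<in>{1..m}. b (- int k))"
proof (induction m)
  case (Suc m)
  have "{- int (Suc m)..int (Suc m)} = insert (int (Suc m)) (insert (- int (Suc m)) {- int m..int m})"
    by auto
  then show ?case using Suc by simp
qed simp

lemma finite_int_subset_symmetric: "finite J \<Longrightarrow> \<exists>m. J \<subseteq> {- int m..int m}"
proof (induction J rule: finite_induct)
  case (insert n J)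
  then obtain m where "J \<subseteq> {- int m..int m}" by blast
  moreover have "n \<in> {- \<bar>n\<bar>..\<bar>n\<bar>}" by auto
  ultimately show ?case by (intro exI[of _ "max m (nat \<bar>n\<bar>)"]) (fastforce simp: subset_iff)
qed simp

lemma fhc_imp_summability_condition:
  assumes p: "2 \<le> p"
    and fhc: "frequent_hypercyclicity_criterion
      (Lp M p :: ('k::{real_normed_field, euclidean_space}, ('a \<Rightarrow> 'k) set) normed_space)
      (composition_operator M p f)"
  shows "summability_condition M f"
proof -
  interpret lp_space M p by unfold_locales (use p in simp)
  let ?L = "Lp M p :: ('k, ('a \<Rightarrow> 'k) set) normed_space"
  let ?T = "composition_operator M p f :: ('a \<Rightarrow> 'k) set \<Rightarrow> ('a \<Rightarrow> 'k) set"
  obtain H S where HS: "dense_in ?L H \<and> S \<in> H \<rightarrow> H \<and> (\<forall>A\<in>H.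
      unconditionally_convergent ?L (\<lambda>n. (?T ^^ n) A) {1..} \<and>
      unconditionally_convergent ?L (\<lambda>n. (S ^^ n) A) {1..} \<and> ?T (S A) = A)"
    using fhc unfolding frequent_hypercyclicity_criterion_def by (elim exE)
  then have dense: "dense_in ?L H" and S: "S \<in> H \<rightarrow> H"
    and conv_T: "\<And>A. A \<in> H \<Longrightarrow> unconditionally_convergent ?L (\<lambda>n. (?T ^^ n) A) {1..}"
    and conv_S: "\<And>A. A \<in> H \<Longrightarrow> unconditionally_convergent ?L (\<lambda>n. (S ^^ n) A) {1..}"
    and TS: "\<And>A. A \<in> H \<Longrightarrow> ?T (S A) = A"
    by auto
  \<comment> \<open>Collecting all representatives turns density of classes into approximation by
    functions.\<close>
  define D where "D = {\<phi> \<in> lp_functions M p. lp_class M p \<phi> \<in> H}"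
  have H_eq: "H = lp_class M p ` D"
    using dense by (auto simp: D_def dense_in_def carrier_Lp)
  have approx: "\<exists>\<phi>\<in>D. lp_integral M p (\<lambda>x. g x - \<phi> x) < e"
    if "g \<in> lp_functions M p" "0 < e" for g e
    using dense that unfolding H_eq by (subst (asm) dense_in_Lp_iff) (auto simp: D_def)
  \<comment> \<open>The identity \<open>?T (S A) = A\<close> is known on \<open>H\<close> only, so
    the powers of \<open>S\<close> must stay in \<open>H\<close>.\<close>
  have S_funpow: "(S ^^ n) A \<in> H" if "A \<in> H" for n A
    by (induction n) (use that S in auto)
  have TS_funpow: "(?T ^^ n) ((S ^^ n) A) = A" if "A \<in> H" for n A
  proof (induction n)
    case (Suc n)
    have "(?T ^^ Suc n) ((S ^^ Suc n) A) = (?T ^^ n) (?T (S ((S ^^ n) A)))"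
      by (simp add: funpow_swap1)
    with Suc show ?case by (simp add: TS S_funpow that)
  qed simp
  have T_funpow: "(?T ^^ n) (lp_class M p \<phi>) = lp_class M p (\<phi> \<circ> f ^^ n)"
    if "\<phi> \<in> lp_functions M p" for \<phi> n
    using that by (intro composition_operator_funpow_lp_class measurable_f AE_f lp_comp_funpow_f)
  have bound: "\<exists>C. \<forall>J::int set. finite J \<longrightarrow> (\<Sum>n\<in>J. lp_integral M p (\<phi> \<circ> iter n)) \<le> C"
    and mem: "\<And>n. \<phi> \<circ> iter n \<in> lp_functions M p" if "\<phi> \<in> D" for \<phi> :: "'a \<Rightarrow> 'k"
  proof -
    have \<phi>: "\<phi> \<in> lp_functions M p" "lp_class M p \<phi> \<in> H" using that by (auto simp: D_def)
    have "\<forall>n. \<exists>\<psi>. \<psi> \<in> lp_functions M p \<and> (S ^^ n) (lp_class M p \<phi>) = lp_class M p \<psi>"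
    proof
      fix n
      have "(S ^^ n) (lp_class M p \<phi>) \<in> lp_class M p ` D"
        using S_funpow[OF \<phi>(2), of n] unfolding H_eq .
      then show "\<exists>\<psi>. \<psi> \<in> lp_functions M p \<and> (S ^^ n) (lp_class M p \<phi>) = lp_class M p \<psi>"
        unfolding D_def by blast
    qed
    from choice[OF this] obtain \<psi> where
      \<psi>: "\<psi> n \<in> lp_functions M p" "(S ^^ n) (lp_class M p \<phi>) = lp_class M p (\<psi> n)" for n
      by blast
    have "lp_class M p (\<psi> n \<circ> f ^^ n) = lp_class M p \<phi>" for n
      using TS_funpow[OF \<phi>(2), of n] T_funpow[OF \<psi>(1)] by (simp add: \<psi>(2))
    note inv = lp_integral_right_inverse[OF p_pos \<phi>(1) \<psi>(1) this]
    show "\<phi> \<circ> iter n \<in> lp_functions M p" for n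
      using lp_comp_funpow_f[OF \<phi>(1)] inv by (cases n rule: int_cases2) (auto simp: iter_nat iter_neg)
    \<comment> \<open>The series of \<open>T\<close> bounds the forward half of the orbit. The
      series of \<open>S\<close> then bounds the backward half, as \<open>\<psi> n\<close> has the
      same integral as \<open>\<phi> \<circ> f_inv ^^ n\<close>.\<close>
    obtain s where "s \<in> lp_functions M p" "((\<lambda>F. lp_integral M p (\<lambda>x. (\<Sum>n\<in>F. (\<phi> \<circ> f ^^ n) x) - s x)) \<longlongrightarrow> 0)
        (finite_subsets_at_top {1..})"
      using conv_T[OF \<phi>(2)] lp_comp_funpow_f[OF \<phi>(1)]
      by (subst (asm) unconditionally_convergent_Lp_iff[where g = "\<lambda>n. \<phi> \<circ> f ^^ n"]) (auto simp: T_funpow[OF \<phi>(1)])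
    from unconditionally_convergent_imp_sum_bounded[OF p lp_comp_funpow_f[OF \<phi>(1)] this]
    obtain C1 where C1: "\<And>F. finite F \<Longrightarrow> F \<subseteq> {1..} \<Longrightarrow> (\<Sum>n\<in>F. lp_integral M p (\<phi> \<circ> f ^^ n)) \<le> C1"
      by blast
    obtain s where "s \<in> lp_functions M p" "((\<lambda>F. lp_integral M p (\<lambda>x. (\<Sum>n\<in>F. \<psi> n x) - s x)) \<longlongrightarrow> 0)
        (finite_subsets_at_top {1..})"
      using conv_S[OF \<phi>(2)] \<psi>
      by (subst (asm) unconditionally_convergent_Lp_iff[where g = \<psi>]) auto
    from unconditionally_convergent_imp_sum_bounded[OF p \<psi>(1) this]
    obtain C2 where C2: "\<And>F. finite F \<Longrightarrow> F \<subseteq> {1..} \<Longrightarrow> (\<Sum>n\<in>F. lp_integral M p (\<psi> n)) \<le> C2"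
      by blast
    have "(\<Sum>n\<in>J. lp_integral M p (\<phi> \<circ> iter n)) \<le> lp_integral M p \<phi> + C1 + C2"
      if J: "finite J" for J
    proof -
      obtain m where m: "J \<subseteq> {- int m..int m}"
        using finite_int_subset_symmetric[OF J] by blast
      have "(\<Sum>n\<in>J. lp_integral M p (\<phi> \<circ> iter n)) \<le>
          (\<Sum>n\<in>{- int m..int m}. lp_integral M p (\<phi> \<circ> iter n))"
        using m by (intro sum_mono2) auto
      also have "\<dots> = lp_integral M p \<phi> + (\<Sum>k\<in>{1..m}. lp_integral M p (\<phi> \<circ> f ^^ k))
          + (\<Sum>k\<in>{1..m}. lp_integral M p (\<psi> k))"
        using inv unfolding sum_symmetric_int_interval[of "\<lambda>n. lp_integral M p (\<phi> \<circ> iter n)"]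
        by (simp only: iter_nat iter_neg iter_0 comp_id)
      also have "\<dots> \<le> lp_integral M p \<phi> + C1 + C2"
        by (intro add_mono order_refl C1 C2) auto
      finally show ?thesis .
    qed
    then show "\<exists>C. \<forall>J::int set. finite J \<longrightarrow> (\<Sum>n\<in>J. lp_integral M p (\<phi> \<circ> iter n)) \<le> C"
      by blast
  qed
  show ?thesis
    unfolding summability_condition_def
  proof (intro allI ballI impI, elim conjE)
    fix \<epsilon> :: real and B assume \<epsilon>: "0 < \<epsilon>" and B: "B \<in> sets M" "emeasure M B < \<infinity>"
    define v :: "'a \<Rightarrow> 'k" where "v x = (if x \<in> B then 1 else 0)" for x
    have "norm (v x) powr p = indicator B x" for x
      by (simp add: v_def)
    then have v: "v \<in> lp_functions M p"
      using B by (auto simp: lp_functions_def v_def[abs_def] intro!: measurable_If_set)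
    \<comment> \<open>The factor \<open>(1 / 2) powr p\<close> is the Markov constant for the
      threshold 1/2 in \<open>B'\<close>: on \<open>B - B'\<close> the function \<open>v\<close> is
      1 while \<open>\<phi>\<close> has norm below 1/2.\<close>
    obtain \<phi> where \<phi>: "\<phi> \<in> D" "lp_integral M p (\<lambda>x. v x - \<phi> x) < \<epsilon> * (1 / 2) powr p"
      using approx[OF v, of "\<epsilon> * (1 / 2) powr p"] \<epsilon> by auto
    have \<phi>_lp: "\<phi> \<in> lp_functions M p" using \<phi>(1) by (simp add: D_def)
    note [measurable] = lp_measurable[OF \<phi>_lp] B(1)
    define B' where "B' = {x \<in> space M. x \<in> B \<and> 1 / 2 \<le> norm (\<phi> x)}"
    have B': "B' \<in> sets M" unfolding B'_def by measurable
    have "emeasure M (B - B') \<le> ennreal (lp_integral M p (\<lambda>x. v x - \<phi> x) / (1 / 2) powr p)"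
    proof (intro emeasure_le_lp_integral lp_diff v \<phi>_lp)
      show "B - B' \<in> sets M" using B(1) B' by auto
      fix x assume "x \<in> B - B'"
      then have "x \<in> B" "norm (\<phi> x) < 1 / 2"
        using sets.sets_into_space[OF B(1)] by (auto simp: B'_def)
      then show "1 / 2 \<le> norm (v x - \<phi> x)"
        using norm_triangle_ineq2[of 1 "\<phi> x"] by (simp add: v_def)
    qed simp
    also have "\<dots> < ennreal \<epsilon>"
      using \<phi>(2) \<epsilon> by (intro ennreal_lessI) (auto simp: field_simps)
    finally have small: "emeasure M (B - B') < ennreal \<epsilon>" .
    obtain C where C: "\<And>J::int set. finite J \<Longrightarrow> (\<Sum>n\<in>J. lp_integral M p (\<phi> \<circ> iter n)) \<le> C"
      using bound[OF \<phi>(1)] by blast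
    \<comment> \<open>The image of \<open>B'\<close> under \<open>iter n\<close> is its preimage
      under \<open>iter (- n)\<close>, where \<open>\<phi> \<circ> iter (- n)\<close> has norm at
      least 1/2.\<close>
    have image_le: "emeasure M (iter n ` B') \<le> ennreal (lp_integral M p (\<phi> \<circ> iter (- n)) / (1 / 2) powr p)" for n
      unfolding image_iter[OF B']
      by (intro emeasure_le_lp_integral mem[OF \<phi>(1)] vimage_iter_sets[OF B']) (auto simp: B'_def)
    have "(\<Sum>\<^sub>\<infinity>n. emeasure M (iter n ` B')) \<le> ennreal (C / (1 / 2) powr p)"
    proof (subst nonneg_infsum_complete, simp, intro SUP_least, clarify)
      fix J :: "int set" assume J: "finite J"
      have "(\<Sum>n\<in>J. emeasure M (iter n ` B')) \<le>
          (\<Sum>n\<in>J. ennreal (lp_integral M p (\<phi> \<circ> iter (- n)) / (1 / 2) powr p))"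
        by (intro sum_mono image_le)
      also have "\<dots> = ennreal (\<Sum>n\<in>J. lp_integral M p (\<phi> \<circ> iter (- n)) / (1 / 2) powr p)"
        by (intro sum_ennreal) auto
      also have "(\<Sum>n\<in>J. lp_integral M p (\<phi> \<circ> iter (- n)) / (1 / 2) powr p) =
          (\<Sum>n\<in>uminus ` J. lp_integral M p (\<phi> \<circ> iter n)) / (1 / 2) powr p"
        by (subst sum.reindex) (auto simp: sum_divide_distrib)
      also have "ennreal \<dots> \<le> ennreal (C / (1 / 2) powr p)"
        using J by (intro ennreal_leI divide_right_mono C) auto
      finally show "(\<Sum>n\<in>J. emeasure M (iter n ` B')) \<le> ennreal (C / (1 / 2) powr p)" .
    qed
    then have "(\<Sum>\<^sub>\<infinity>n. emeasure M (iter n ` B')) < \<infinity>"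
      by (rule le_less_trans) simp
    then show "\<exists>B'\<in>sets M. B' \<subseteq> B \<and> emeasure M (B - B') < ennreal \<epsilon> \<and>
        (\<Sum>\<^sub>\<infinity>n. emeasure M (iter n ` B')) < \<infinity>"
      using B' small by (intro bexI[of _ B']) (auto simp: B'_def)
  qed
qed

end

section \<open>From the summability condition to the criterion\<close>

text \<open>Enumerating the integers gives a series, for which measurability and termwise
  integration are available.\<close>

lemma infsum_int_eq_suminf:
  fixes u :: "int \<Rightarrow> ennreal"
  shows "(\<Sum>\<^sub>\<infinity>n. u n) = (\<Sum>k. u (int_decode k))"
proof -
  have "(\<Sum>\<^sub>\<infinity>n. u n) = (\<Sum>\<^sub>\<infinity>k. u (int_decode k))"
    by (rule infsum_reindex_bij_betw[symmetric]) (rule bij_int_decode)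
  also have "\<dots> = (\<Sum>k. u (int_decode k))"
    by (intro sums_unique has_sum_imp_sums has_sum_infsum nonneg_summable_on_complete) simp
  finally show ?thesis .
qed

context measurable_system
begin

text \<open>The functions whose orbit is absolutely summable with sum in \<open>L\<^sup>p\<close>; the classes of these
  functions are the dense set of the criterion.\<close>

definition dominated_orbit ::
    "real \<Rightarrow> ('a \<Rightarrow> 'k::{real_normed_field, euclidean_space}) set" where
  "dominated_orbit p = {\<phi>. \<phi> \<in> borel_measurable M \<and>
    (\<exists>h. integrable M (\<lambda>x. h x powr p) \<and>
      (\<forall>x\<in>space M. \<forall>J. finite J \<longrightarrow> (\<Sum>n\<in>J. norm (\<phi> (iter n x))) \<le> h x))}"

text \<open>A shift permutes the orbit, so the same bound \<open>h\<close> serves. This makes the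
  dense set invariant under \<open>S\<close>.\<close>

lemma dominated_orbit_iter:
  assumes "\<phi> \<in> dominated_orbit p"
  shows "\<phi> \<circ> iter m \<in> dominated_orbit p"
proof -
  obtain h where h: "integrable M (\<lambda>x. h x powr p)"
    "\<And>x J. x \<in> space M \<Longrightarrow> finite J \<Longrightarrow> (\<Sum>n\<in>J. norm (\<phi> (iter n x))) \<le> h x"
    and \<phi>: "\<phi> \<in> borel_measurable M"
    using assms unfolding dominated_orbit_def by blast
  have "(\<Sum>n\<in>J. norm ((\<phi> \<circ> iter m) (iter n x))) \<le> h x" if x: "x \<in> space M" and J: "finite J" for x J
  proof -
    have "(\<Sum>n\<in>J. norm ((\<phi> \<circ> iter m) (iter n x))) = (\<Sum>n\<in>(+) m ` J. norm (\<phi> (iter n x)))"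
      by (subst sum.reindex) (auto simp: iter_add x)
    then show ?thesis using h(2)[OF x, of "(+) m ` J"] J by simp
  qed
  then show ?thesis
    using measurable_comp[OF measurable_iter \<phi>] h(1) unfolding dominated_orbit_def by blast
qed

lemma dominated_orbit_lp:
  assumes "0 < p" "\<phi> \<in> dominated_orbit p"
  shows "\<phi> \<in> lp_functions M p"
proof -
  interpret lp_space M p by unfold_locales (rule assms)
  obtain h where h: "integrable M (\<lambda>x. h x powr p)"
    "\<And>x J. x \<in> space M \<Longrightarrow> finite J \<Longrightarrow> (\<Sum>n\<in>J. norm (\<phi> (iter n x))) \<le> h x"
    and \<phi>: "\<phi> \<in> borel_measurable M"
    using assms unfolding dominated_orbit_def by blast
  show ?thesis
    by (rule dominated_lp_functions[OF \<phi> h(1)]) (use h(2)[of _ "{0}"] in \<open>simp add: iter_0\<close>)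
qed

text \<open>The injection covers both series of the criterion, \<open>int n\<close> for the operator
  and \<open>- int n\<close> for its right inverse.\<close>

lemma dominated_orbit_unconditionally_convergent:
  fixes \<phi> :: "'a \<Rightarrow> 'k::{real_normed_field, euclidean_space}"
  assumes "0 < p" and \<phi>: "\<phi> \<in> dominated_orbit p" and "inj \<iota>"
    and A: "\<And>n. A n = lp_class M p (\<phi> \<circ> iter (\<iota> n))"
  shows "unconditionally_convergent (Lp M p) A {1::nat..}"
proof -
  interpret lp_space M p by unfold_locales (rule assms)
  obtain h where h: "integrable M (\<lambda>x. h x powr p)"
    "\<And>x J. x \<in> space M \<Longrightarrow> finite J \<Longrightarrow> (\<Sum>n\<in>J. norm (\<phi> (iter n x))) \<le> h x"
    and \<phi>_meas: "\<phi> \<in> borel_measurable M"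
    using \<phi> unfolding dominated_orbit_def by blast
  have lp: "\<phi> \<circ> iter (\<iota> n) \<in> lp_functions M p" for n
    by (intro dominated_orbit_lp dominated_orbit_iter \<phi> p_pos)
  have "(\<Sum>n\<in>J. norm ((\<phi> \<circ> iter (\<iota> n)) x)) \<le> h x" if "x \<in> space M" "finite J" for x J
  proof -
    have "(\<Sum>n\<in>J. norm ((\<phi> \<circ> iter (\<iota> n)) x)) = (\<Sum>n\<in>\<iota> ` J. norm (\<phi> (iter n x)))"
      using inj_on_subset[OF \<open>inj \<iota>\<close>] by (subst sum.reindex) auto
    then show ?thesis using h(2)[of x "\<iota> ` J"] that by simp
  qed
  then show ?thesis
    unfolding unconditionally_convergent_Lp_iff[OF lp A]
    by (intro dominated_unconditionally_convergent[OF lp_measurable[OF lp] h(1)])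
qed

lemma dominated_orbit_dense:
  fixes v :: "'a \<Rightarrow> 'k::{real_normed_field, euclidean_space}"
  assumes p: "1 \<le> p" and sc: "summability_condition M f"
    and v: "v \<in> lp_functions M p" and e: "0 < e"
  shows "\<exists>\<phi>\<in>dominated_orbit p. lp_integral M p (\<lambda>x. v x - \<phi> x) < e"
proof -
  interpret lp_space M p by unfold_locales (use p in simp)
  note [measurable] = lp_measurable[OF v]
  \<comment> \<open>These sets increase to the set where \<open>v\<close> is nonzero. The upper
    bound makes \<open>v\<close> bounded on them, the lower bound makes their measure
    finite.\<close>
  define E where "E k = {x \<in> space M. 1 / (real k + 1) \<le> norm (v x) \<and> norm (v x) \<le> real k + 1}" for k
  have [measurable]: "E k \<in> sets M" for k unfolding E_def by measurable
  have "(\<lambda>k. LINT x|M. norm (v x) powr p * indicator (space M - E k) x) \<longlonglongrightarrow> (LINT x|M. 0)"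
  proof (rule integral_dominated_convergence[OF _ _ lp_integrable[OF v]])
    show "AE x in M. (\<lambda>k. norm (v x) powr p * indicator (space M - E k) x) \<longlonglongrightarrow> 0"
    proof (rule AE_I2)
      fix x assume x: "x \<in> space M"
      show "(\<lambda>k. norm (v x) powr p * indicator (space M - E k) x) \<longlonglongrightarrow> 0"
      proof (cases "v x = 0")
        case False
        obtain k0 :: nat where k0: "max (norm (v x)) (1 / norm (v x)) \<le> real k0"
          using real_arch_simple by blast
        have "x \<in> E k" if "k0 \<le> k" for k
        proof -
          have "norm (v x) \<le> real k + 1" "1 / norm (v x) \<le> real k + 1"
            using k0 that by auto
          then show ?thesis using x False by (simp add: E_def field_simps)
        qed
        then have "\<forall>\<^sub>F k in sequentially. norm (v x) powr p * indicator (space M - E k) x = 0"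
          by (auto simp: eventually_sequentially indicator_def intro!: exI[of _ k0])
        then show ?thesis by (rule tendsto_eventually)
      qed simp
    qed
  qed (auto split: split_indicator)
  then have "(\<lambda>k. LINT x|M. norm (v x) powr p * indicator (space M - E k) x) \<longlonglongrightarrow> 0" by simp
  from order_tendstoD(2)[OF this, of "e / 2"] e obtain k
    where k: "(LINT x|M. norm (v x) powr p * indicator (space M - E k) x) < e / 2"
    by (auto simp: eventually_sequentially)
  define K where "K = real k + 1"
  have K: "0 < K" by (simp add: K_def)
  \<comment> \<open>The set \<open>E k - C\<close> will have measure below
    \<open>2 * \<delta>\<close>, and \<open>norm (v x) powr p\<close> is at most
    \<open>K powr p\<close> there, so this choice keeps the error below
    \<open>e / 2\<close>.\<close>
  define \<delta> where "\<delta> = e / (4 * K powr p)"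
  have \<delta>: "0 < \<delta>" using e K by (simp add: \<delta>_def)
  have "emeasure M (E k) \<le> ennreal (lp_integral M p v / (1 / K) powr p)"
    using K by (intro emeasure_le_lp_integral v) (auto simp: E_def K_def)
  then have E_fin: "emeasure M (E k) < \<infinity>" by (rule le_less_trans) simp
  obtain B where B[measurable]: "B \<in> sets M" and B_sub: "B \<subseteq> E k"
    and B_small: "emeasure M (E k - B) < ennreal \<delta>"
    and B_sum: "(\<Sum>\<^sub>\<infinity>n. emeasure M (iter n ` B)) < \<infinity>"
    using sc[unfolded summability_condition_def, rule_format, of "E k" \<delta>] \<delta> E_fin by auto
  \<comment> \<open>The number of visits of the orbit to \<open>B\<close>. Its integral is the sum
    in the summability condition, hence finite.\<close>
  define N :: "'a \<Rightarrow> ennreal" where "N x = (\<Sum>\<^sub>\<infinity>n. indicator B (iter n x))" for x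
  have [measurable]: "iter n \<in> measurable M M" for n by (rule measurable_iter)
  have N_meas[measurable]: "N \<in> borel_measurable M"
    unfolding N_def infsum_int_eq_suminf by measurable
  have N_inv: "N (iter m x) = N x" if "x \<in> space M" for m x
  proof -
    have "N (iter m x) = (\<Sum>\<^sub>\<infinity>n. indicator B (iter (n + m) x))"
      by (simp add: N_def iter_add that)
    also have "\<dots> = N x"
      unfolding N_def by (rule infsum_reindex_bij_betw) (rule bij_plus_right)
    finally show ?thesis .
  qed
  have "(\<integral>\<^sup>+x. N x \<partial>M) = (\<Sum>k. \<integral>\<^sup>+x. indicator B (iter (int_decode k) x) \<partial>M)"
    unfolding N_def infsum_int_eq_suminf by (rule nn_integral_suminf) measurable
  also have "\<dots> = (\<Sum>k. emeasure M (iter (int_decode k) -` B \<inter> space M))"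
  proof (intro suminf_cong)
    fix k
    have "(\<integral>\<^sup>+x. indicator B (iter (int_decode k) x) \<partial>M) =
        (\<integral>\<^sup>+x. indicator (iter (int_decode k) -` B \<inter> space M) x \<partial>M)"
      by (intro nn_integral_cong) (auto split: split_indicator)
    then show "(\<integral>\<^sup>+x. indicator B (iter (int_decode k) x) \<partial>M) = emeasure M (iter (int_decode k) -` B \<inter> space M)"
      by simp
  qed
  also have "\<dots> = (\<Sum>\<^sub>\<infinity>n. emeasure M (iter n -` B \<inter> space M))"
    by (rule infsum_int_eq_suminf[symmetric])
  also have "\<dots> = (\<Sum>\<^sub>\<infinity>n. emeasure M (iter (- n) -` B \<inter> space M))"
    by (rule infsum_reindex_bij_betw[symmetric]) (rule bij_uminus)
  also have "\<dots> = (\<Sum>\<^sub>\<infinity>n. emeasure M (iter n ` B))"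
    by (simp add: image_iter)
  finally have N_fin: "(\<integral>\<^sup>+x. N x \<partial>M) < \<infinity>" using B_sum by simp
  define I where "I = enn2real (\<integral>\<^sup>+x. N x \<partial>M)"
  have I: "(\<integral>\<^sup>+x. N x \<partial>M) = ennreal I" "0 \<le> I"
    using N_fin by (simp_all add: I_def)
  \<comment> \<open>By Markov's inequality the points of \<open>B\<close> with at least
    \<open>m\<close> visits have measure at most \<open>I / m\<close>. The added 1 keeps
    \<open>m\<close> positive and \<open>I / m < \<delta>\<close> strict even for
    \<open>I = 0\<close>.\<close>
  define m where "m = (I + 1) / \<delta>"
  have m: "0 < m" "I / m < \<delta>"
    using I(2) \<delta> by (simp_all add: m_def field_simps)
  define C where "C = {x \<in> B. N x < ennreal m}"
  have "C = {x \<in> space M. x \<in> B \<and> N x < ennreal m}"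
    using sets.sets_into_space[OF B] by (auto simp: C_def)
  then have C[measurable]: "C \<in> sets M" by simp
  have BC_small: "emeasure M (B - C) < ennreal \<delta>"
  proof -
    have one_le: "1 \<le> ennreal (1 / m) * N x" if "ennreal m \<le> N x" for x
    proof -
      have "1 = ennreal (1 / m) * ennreal m"
        using m(1) by (simp flip: ennreal_mult)
      also have "\<dots> \<le> ennreal (1 / m) * N x" using that by (intro mult_left_mono) auto
      finally show ?thesis .
    qed
    have "emeasure M (B - C) = (\<integral>\<^sup>+x. indicator (B - C) x \<partial>M)" by simp
    also have "\<dots> \<le> (\<integral>\<^sup>+x. ennreal (1 / m) * N x \<partial>M)"
      using one_le by (intro nn_integral_mono) (auto simp: C_def not_less split: split_indicator)
    also have "\<dots> = ennreal (I / m)"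
      using m(1) I by (simp add: nn_integral_cmult ennreal_mult[symmetric])
    also have "\<dots> < ennreal \<delta>" using m(2) \<delta> by (intro ennreal_lessI)
    finally show ?thesis .
  qed
  have EC: "emeasure M (E k - C) < ennreal (2 * \<delta>)"
  proof -
    have "emeasure M (E k - C) \<le> emeasure M ((E k - B) \<union> (B - C))"
      by (intro emeasure_mono) auto
    also have "\<dots> \<le> emeasure M (E k - B) + emeasure M (B - C)"
      by (intro emeasure_subadditive) auto
    also have "\<dots> < ennreal \<delta> + ennreal \<delta>"
      using B_small BC_small by (rule add_strict_mono)
    finally show ?thesis using \<delta> by (simp flip: ennreal_plus)
  qed
  define \<phi> where "\<phi> x = (if x \<in> C then v x else 0)" for x
  have [measurable]: "\<phi> \<in> borel_measurable M" unfolding \<phi>_def by measurable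
  \<comment> \<open>The value 0 is a valid bound where \<open>N\<close> reaches \<open>m\<close>: by
    invariance of \<open>N\<close> such an orbit never meets \<open>C\<close>, so
    \<open>\<phi>\<close> vanishes along it.\<close>
  define u where "u x = (if N x < ennreal m then enn2real (N x) else 0)" for x
  have [measurable]: "u \<in> borel_measurable M" unfolding u_def by measurable
  have u: "0 \<le> u x" "u x \<le> m" "ennreal (u x) \<le> N x" for x
  proof -
    have "enn2real (N x) \<le> m" if "N x < ennreal m"
      using that m(1) enn2real_mono[of "N x" "ennreal m"] by simp
    then show "0 \<le> u x" "u x \<le> m" "ennreal (u x) \<le> N x"
      using m(1) by (auto simp: u_def ennreal_enn2real less_trans[OF _ ennreal_less_top])
  qed
  have u_int: "integrable M u"
  proof (rule integrableI_bounded)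
    have "(\<integral>\<^sup>+x. ennreal (norm (u x)) \<partial>M) \<le> (\<integral>\<^sup>+x. N x \<partial>M)"
      using u by (intro nn_integral_mono) simp
    then show "(\<integral>\<^sup>+x. ennreal (norm (u x)) \<partial>M) < \<infinity>" using N_fin by (rule le_less_trans)
  qed simp
  \<comment> \<open>As \<open>u\<close> is bounded by \<open>m\<close> and
    \<open>p - 1 \<ge> 0\<close>, the \<open>p\<close>-th power is at most a constant times the
    integrable \<open>u\<close>.\<close>
  have Ku_int: "integrable M (\<lambda>x. (K * u x) powr p)"
  proof (rule Bochner_Integration.integrable_bound)
    show "integrable M (\<lambda>x. (K * m) powr (p - 1) * (K * u x))" using u_int by simp
    show "AE x in M. norm ((K * u x) powr p) \<le> norm ((K * m) powr (p - 1) * (K * u x))"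
    proof (intro AE_I2)
      fix x
      have "(K * u x) powr p = (K * u x) powr (p - 1) * (K * u x)"
        using K u(1)[of x] by (cases "u x = 0") (simp_all add: powr_diff)
      also have "\<dots> \<le> (K * m) powr (p - 1) * (K * u x)"
        using K u[of x] p by (intro mult_right_mono powr_mono2 mult_left_mono) auto
      finally show "norm ((K * u x) powr p) \<le> norm ((K * m) powr (p - 1) * (K * u x))"
        using K u(1)[of x] by (simp add: abs_mult)
    qed
  qed measurable
  have "(\<Sum>n\<in>J. norm (\<phi> (iter n x))) \<le> K * u x" if x: "x \<in> space M" and J: "finite J" for x J
  proof (cases "N x < ennreal m")
    case True
    have "ennreal (\<Sum>n\<in>J. indicator B (iter n x)) = (\<Sum>n\<in>J. indicator B (iter n x))"
      by (subst sum_ennreal[symmetric]) (auto simp: ennreal_indicator)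
    also have "\<dots> \<le> N x"
      unfolding N_def using J by (subst nonneg_infsum_complete) (auto intro: SUP_upper)
    also have "N x = ennreal (u x)"
      using True by (simp add: u_def ennreal_enn2real less_trans[OF True ennreal_less_top])
    finally have count: "(\<Sum>n\<in>J. indicator B (iter n x)) \<le> u x"
      using u(1) by (simp add: ennreal_le_iff)
    have "norm (\<phi> y) \<le> K * indicator B y" for y
      using B_sub K by (auto simp: \<phi>_def C_def E_def K_def split: split_indicator)
    then have "(\<Sum>n\<in>J. norm (\<phi> (iter n x))) \<le> (\<Sum>n\<in>J. K * indicator B (iter n x))"
      by (intro sum_mono)
    also have "\<dots> = K * (\<Sum>n\<in>J. indicator B (iter n x))" by (simp add: sum_distrib_left)
    also have "\<dots> \<le> K * u x" using count K by (intro mult_left_mono) auto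
    finally show ?thesis .
  next
    case False
    then have "\<phi> (iter n x) = 0" for n by (simp add: \<phi>_def C_def N_inv x)
    then show ?thesis using K u(1)[of x] by simp
  qed
  then have "\<phi> \<in> dominated_orbit p"
    using Ku_int unfolding dominated_orbit_def by (auto intro!: exI[of _ "\<lambda>x. K * u x"])
  moreover have "lp_integral M p (\<lambda>x. v x - \<phi> x) < e"
  proof -
    have E'_fin: "emeasure M (E k - C) < \<infinity>" using EC by (rule less_trans) simp
    have "lp_integral M p (\<lambda>x. v x - \<phi> x) \<le>
        (LINT x|M. norm (v x) powr p * indicator (space M - E k) x + K powr p * indicator (E k - C) x)"
    proof (rule integral_mono)
      have int1: "integrable M (\<lambda>x. norm (v x) powr p * indicator (space M - E k) x)"
        by (rule Bochner_Integration.integrable_bound[OF lp_integrable[OF v]]) (auto split: split_indicator)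
      show "integrable M (\<lambda>x. norm (v x) powr p * indicator (space M - E k) x + K powr p * indicator (E k - C) x)"
        using int1 E'_fin by (intro Bochner_Integration.integrable_add integrable_mult_right) auto
      have le: "norm (v x - \<phi> x) powr p \<le> norm (v x) powr p" for x
        by (simp add: \<phi>_def)
      show "integrable M (\<lambda>x. norm (v x - \<phi> x) powr p)"
        using le by (intro Bochner_Integration.integrable_bound[OF lp_integrable[OF v]]) auto
      fix x assume x: "x \<in> space M"
      consider "x \<in> C" | "x \<in> E k - C" | "x \<notin> E k" by blast
      then show "norm (v x - \<phi> x) powr p \<le>
          norm (v x) powr p * indicator (space M - E k) x + K powr p * indicator (E k - C) x"
      proof cases
        case 1
        then show ?thesis by (simp add: \<phi>_def)
      next
        case 2
        then have "norm (v x) powr p \<le> K powr p"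
          using p by (intro powr_mono2) (auto simp: E_def K_def)
        with 2 show ?thesis by (simp add: \<phi>_def)
      next
        case 3
        then show ?thesis using le[of x] x by simp
      qed
    qed
    also have "\<dots> = (LINT x|M. norm (v x) powr p * indicator (space M - E k) x) + K powr p * measure M (E k - C)"
    proof -
      have int1: "integrable M (\<lambda>x. norm (v x) powr p * indicator (space M - E k) x)"
        by (rule Bochner_Integration.integrable_bound[OF lp_integrable[OF v]]) (auto split: split_indicator)
      show ?thesis using int1 E'_fin by (subst Bochner_Integration.integral_add) auto
    qed
    also have "\<dots> < e / 2 + K powr p * (2 * \<delta>)"
    proof (intro add_strict_mono k mult_strict_left_mono)
      show "measure M (E k - C) < 2 * \<delta>"
        using EC E'_fin \<delta> by (simp add: emeasure_eq_ennreal_measure ennreal_less_iff)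
    qed (use K in simp)
    also have "\<dots> = e" using K by (simp add: \<delta>_def)
    finally show ?thesis .
  qed
  ultimately show ?thesis by blast
qed

text \<open>The right inverse is composition with the inverse of \<open>f\<close>. Since the
  distortion bound is one-sided, it need not act on all of \<open>Lp M p\<close>, but it maps the
  dense set to itself, as the criterion asks.\<close>

lemma summability_condition_imp_fhc:
  assumes p: "1 \<le> p" and sc: "summability_condition M f"
  shows "frequent_hypercyclicity_criterion
    (Lp M p :: ('k::{real_normed_field, euclidean_space}, ('a \<Rightarrow> 'k) set) normed_space)
    (composition_operator M p f)"
proof -
  interpret lp_space M p by unfold_locales (use p in simp)
  let ?L = "Lp M p :: ('k, ('a \<Rightarrow> 'k) set) normed_space"
  let ?T = "composition_operator M p f :: ('a \<Rightarrow> 'k) set \<Rightarrow> ('a \<Rightarrow> 'k) set"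
  let ?S = "composition_operator M p f_inv :: ('a \<Rightarrow> 'k) set \<Rightarrow> ('a \<Rightarrow> 'k) set"
  let ?D = "dominated_orbit p :: ('a \<Rightarrow> 'k) set"
  have D_lp: "?D \<subseteq> lp_functions M p" using dominated_orbit_lp[OF p_pos] by blast
  have iter_lp: "\<phi> \<circ> iter n \<in> lp_functions M p" if "\<phi> \<in> ?D" for \<phi> n
    using that by (intro dominated_orbit_lp dominated_orbit_iter p_pos)
  have f_lp: "\<phi> \<circ> f ^^ n \<in> lp_functions M p" and f_inv_lp: "\<phi> \<circ> f_inv ^^ n \<in> lp_functions M p"
    if "\<phi> \<in> ?D" for \<phi> n
    using iter_lp[OF that, of "int n"] iter_lp[OF that, of "- int n"] by (simp_all only: iter_nat iter_neg)
  have T: "(?T ^^ n) (lp_class M p \<phi>) = lp_class M p (\<phi> \<circ> iter (int n))" if "\<phi> \<in> ?D" for \<phi> n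
    unfolding iter_nat
    by (rule composition_operator_funpow_lp_class[OF measurable_f AE_f f_lp[OF that]])
  have S: "(?S ^^ n) (lp_class M p \<phi>) = lp_class M p (\<phi> \<circ> iter (- int n))" if "\<phi> \<in> ?D" for \<phi> n
    unfolding iter_neg
    by (rule composition_operator_funpow_lp_class[OF measurable_f_inv AE_f_inv f_inv_lp[OF that]])
  have S1: "?S (lp_class M p \<phi>) = lp_class M p (\<phi> \<circ> iter (- 1))" if "\<phi> \<in> ?D" for \<phi>
    using S[OF that, of 1] by simp
  have TS: "?T (?S (lp_class M p \<phi>)) = lp_class M p \<phi>" if "\<phi> \<in> ?D" for \<phi>
  proof -
    have "?T (lp_class M p (\<phi> \<circ> iter (- 1))) = lp_class M p ((\<phi> \<circ> iter (- 1)) \<circ> iter 1)"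
      using T[OF dominated_orbit_iter[OF that], of 1 "- 1"] by simp
    \<comment> \<open>The iterates are known to cancel on the space of \<open>M\<close> only, so the
      functions are compared almost everywhere.\<close>
    also have "\<dots> = lp_class M p \<phi>"
    proof (rule lp_class_eqI)
      show "(\<phi> \<circ> iter (- 1)) \<circ> iter 1 \<in> lp_functions M p"
        by (rule iter_lp[OF dominated_orbit_iter[OF that]])
      show "\<phi> \<in> lp_functions M p" using that D_lp by blast
      show "AE x in M. ((\<phi> \<circ> iter (- 1)) \<circ> iter 1) x = \<phi> x"
        by (intro AE_I2) (simp add: iter_add iter_0)
    qed
    finally show ?thesis by (simp only: S1[OF that])
  qed
  have "dense_in ?L (lp_class M p ` ?D)"
    using dominated_orbit_dense[OF p sc] D_lp by (subst dense_in_Lp_iff[OF D_lp]) blast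
  moreover have "?S \<in> lp_class M p ` ?D \<rightarrow> lp_class M p ` ?D"
    by (auto simp: S1 intro!: imageI dominated_orbit_iter)
  moreover have "unconditionally_convergent ?L (\<lambda>n. (?T ^^ n) (lp_class M p \<phi>)) {1..}"
    and "unconditionally_convergent ?L (\<lambda>n. (?S ^^ n) (lp_class M p \<phi>)) {1..}" if "\<phi> \<in> ?D" for \<phi>
    by (rule dominated_orbit_unconditionally_convergent[OF p_pos that _ T[OF that]], simp add: inj_on_def,
      rule dominated_orbit_unconditionally_convergent[OF p_pos that _ S[OF that]], simp add: inj_on_def)
  ultimately show ?thesis
    unfolding frequent_hypercyclicity_criterion_def
    by (intro exI[of _ "lp_class M p ` ?D"] exI[of _ ?S] conjI ballI; (elim imageE)?) (simp_all add: TS)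
qed

end

theorem theorem3p1:
  fixes M :: "'a measure" and f :: "'a \<Rightarrow> 'a"
  assumes "measurable_system M f"
  shows
    "(\<forall>p::real. p \<ge> 1 \<longrightarrow> summability_condition M f \<longrightarrow>
        frequent_hypercyclicity_criterion
          (Lp M p :: ('k::{real_normed_field, euclidean_space}, ('a \<Rightarrow> 'k) set) normed_space)
          (composition_operator M p f)) \<and>
     (\<forall>p::real. p \<ge> 2 \<longrightarrow>
        (summability_condition M f \<longleftrightarrow>
          frequent_hypercyclicity_criterion
            (Lp M p :: ('k, ('a \<Rightarrow> 'k) set) normed_space)
            (composition_operator M p f)))"
proof -
  interpret measurable_system M f by (rule assms)
  show ?thesis
    using summability_condition_imp_fhc fhc_imp_summability_condition by fastforce
qed

end
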